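(* Let $d \geq 2$ be an integer, let $m \geq 0$ be an integer with $(d-1) \mid (m+1)$, and set $a = (m+1)/(d-1)$. Assume that $d$ is factorized as $d = p_1^{t_1} p_2^{t_2} \cdots p_s^{t_s}$, where $s, t_1, \dots, t_s$ are positive integers and $p_1, \dots, p_s$ are distinct prime numbers. Let $b_{d,m}$ be the coefficient of $z^{-m}$ in the Laurent expansion at infinity of the normalized conformal map $\Psi_d$ from the exterior of the closed unit disk onto the complement of the degree-$d$ Multibrot set. Then for every $p_i \in \{p_1, \dots, p_s\}$, $$-\nu_{p_i}(b_{d,m}) \leq \nu_{p_i}(a!) + t_i a .$$ Furthermore, equality holds if and only if $m = d-2$ or $p_i \nmid m$.
   Context: Let $\widehat{\mathbb{C}}$ be the Riemann sphere and $\mathbb{D}^* = \{z \in \widehat{\mathbb{C}} : |z| > 1\}$ (including $\infty$) the exterior of the closed unit disk. For an integer $d \geq 2$ and $c \in \mathbb{C}$ let $P_{d,c}(z) = z^d + c$. The Julia set of a polynomial $P$ is the set of all $z \in \widehat{\mathbb{C}}$ such that the family of iterates $\{P^{\circ n}\}_{n \geq 0}$ is not normal in any neighborhood of $z$. The Multibrot set $\mathcal{M}_d$ of degree $d$ is the set of all $c \in \mathbb{C}$ for which the Julia set of $P_{d,c}$ is connected; it is compact. It is known (Douady–Hubbard) that there is a conformal homeomorphism $\Phi_d : \widehat{\mathbb{C}} \setminus \mathcal{M}_d \to \mathbb{D}^*$ with $\lim_{z \to \infty} \Phi_d(z)/z = 1$. Put $\Psi_d = \Phi_d^{-1} : \mathbb{D}^*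 \to \widehat{\mathbb{C}} \setminus \mathcal{M}_d$ and define the coefficients $b_{d,m}$ by the Laurent expansion $$\Psi_d(z) = z + \sum_{m=0}^{\infty} b_{d,m} z^{-m}.$$ It is known that each $b_{d,m}$ is a $d$-adic rational number, i.e. of the form $k d^{-n}$ with $k \in \mathbb{Z}$ and $n$ a non-negative integer; in particular it is rational. For a prime $p$, $\nu_p : \mathbb{Q} \to \mathbb{Z} \cup \{+\infty\}$ denotes the $p$-adic valuation: $\nu_p(x) = v$ if $x = p^v r/q$ with integers $r, q$ not divisible by $p$, and $\nu_p(0) = +\infty$ (so $-\nu_p(0) = -\infty$). *)

theory Defs
  imports "HOL-Complex_Analysis.Complex_Analysis" "HOL-Computational_Algebra.Primes"
begin

section \<open>The Riemann sphere\<close>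

text \<open>Points of the sphere are of type \<^typ>\<open>complex option\<close>; \<^term>\<open>None\<close> is the point at infinity.\<close>

definition riemann_sphere :: "complex option topology" where
  "riemann_sphere = Alexandroff_compactification euclidean"

lemma topspace_riemann_sphere [simp]: "topspace riemann_sphere = UNIV"
  by (simp add: riemann_sphere_def UNIV_option_conv)

text \<open>
  The inverse stereographic projection onto the unit sphere of \<open>\<complex> \<times> \<real>\<close>. The distance of the
  image points is the chordal metric; by the theorem below it induces the topology of the sphere.
\<close>

definition stereographic :: "complex option \<Rightarrow> complex \<times> real" where
  "stereographic x = (case x of
      None \<Rightarrow> (0, 1)
    | Some z \<Rightarrow> ((2 / (1 + (cmod z)\<^sup>2)) *\<^sub>R z, ((cmod z)\<^sup>2 - 1) / ((cmod z)\<^sup>2 + 1)))"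

lemma stereographic_Some:
  "stereographic (Some z) = ((2 / ((cmod z)\<^sup>2 + 1)) *\<^sub>R z, 1 - 2 / ((cmod z)\<^sup>2 + 1))"
proof -
  have nz: "(cmod z)\<^sup>2 + 1 \<noteq> 0"
    using zero_le_power2[of "cmod z"] by linarith
  have "((cmod z)\<^sup>2 - 1) / ((cmod z)\<^sup>2 + 1) = 1 - 2 / ((cmod z)\<^sup>2 + 1)"
    using nz by (simp add: field_simps)
  then show ?thesis
    by (simp add: stereographic_def add.commute)
qed

lemma inj_stereographic: "inj stereographic"
proof -
  have nz: "(cmod z)\<^sup>2 + 1 \<noteq> 0" for z
    using zero_le_power2[of "cmod z"] by linarith
  have no_inf: "stereographic (Some z) \<noteq> stereographic None" for z
    using nz[of z] by (simp add: stereographic_Some) (simp add: stereographic_def)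
  have "z = w" if *: "stereographic (Some z) = stereographic (Some w)" for z w
  proof -
    have eq: "2 / ((cmod z)\<^sup>2 + 1) = 2 / ((cmod w)\<^sup>2 + 1)"
      using * unfolding stereographic_Some prod.inject by linarith
    have "(2 / ((cmod z)\<^sup>2 + 1)) *\<^sub>R z = (2 / ((cmod w)\<^sup>2 + 1)) *\<^sub>R w"
      using * unfolding stereographic_Some prod.inject by blast
    then show ?thesis
      unfolding eq using nz[of w] by simp
  qed
  then show ?thesis
    unfolding inj_def using no_inf by (metis option.exhaust)
qed

lemma continuous_map_stereographic: "continuous_map riemann_sphere euclidean stereographic"
proof -
  let ?f = "\<lambda>z. stereographic (Some z)"
  have pos: "(cmod z)\<^sup>2 + 1 > 0" for z
    by (simp add: add_nonneg_pos)
  have nz: "(cmod z)\<^sup>2 + 1 \<noteq> 0" for z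
    using pos[of z] by linarith
  have cont: "continuous_on UNIV ?f"
    unfolding stereographic_Some using nz by (intro continuous_intros) auto
  have sq: "filterlim (\<lambda>z :: complex. (cmod z)\<^sup>2 + 1) at_top at_infinity"
    unfolding power2_eq_square add.commute[of _ 1]
    by (intro filterlim_tendsto_add_at_top[OF tendsto_const] filterlim_at_top_mult_at_top
          filterlim_norm_at_top)
  have "((\<lambda>z. (2 / ((cmod z)\<^sup>2 + 1)) *\<^sub>R z) \<longlongrightarrow> 0) at_infinity"
  proof (rule Lim_null_comparison)
    show "((\<lambda>z :: complex. 2 / cmod z) \<longlongrightarrow> 0) at_infinity"
      by (intro tendsto_divide_0[OF tendsto_const] filterlim_at_top_imp_at_infinity filterlim_norm_at_top)
    have "norm ((2 / ((cmod z)\<^sup>2 + 1)) *\<^sub>R z) \<le> 2 / cmod z" for z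
      using pos[of z] by (cases "z = 0") (simp_all add: divide_simps power2_eq_square)
    then show "\<forall>\<^sub>F z in at_infinity. norm ((2 / ((cmod z)\<^sup>2 + 1)) *\<^sub>R z) \<le> 2 / cmod z"
      by simp
  qed
  moreover have "((\<lambda>z :: complex. 1 - 2 / ((cmod z)\<^sup>2 + 1)) \<longlongrightarrow> 1 - 0) at_infinity"
    by (intro tendsto_intros tendsto_divide_0[OF tendsto_const] filterlim_at_top_imp_at_infinity sq)
  ultimately have lim: "(?f \<longlongrightarrow> stereographic None) at_infinity"
    unfolding stereographic_Some by (auto simp: stereographic_def intro!: tendsto_Pair)
  have "openin riemann_sphere (stereographic -` V)" if "open V" for V
  proof (cases "stereographic None \<in> V")
    case False
    then have "x \<in> stereographic -` V \<longleftrightarrow> x \<in> Some ` (?f -` V)" for x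
      by (cases x) auto
    then have "stereographic -` V = Some ` (?f -` V)"
      by blast
    then show ?thesis
      using open_vimage[OF \<open>open V\<close> cont] by (simp add: riemann_sphere_def)
  next
    case True
    have "eventually (\<lambda>z. ?f z \<in> V) at_infinity"
      using lim True \<open>open V\<close> by (metis topological_tendstoD)
    then obtain B where "\<And>z. norm z \<ge> B \<Longrightarrow> ?f z \<in> V"
      by (auto simp: eventually_at_infinity)
    then have "\<forall>z\<in>- (?f -` V). norm z \<le> B"
      by (meson ComplD nle_le vimageI2)
    then have "bounded (- (?f -` V))"
      unfolding bounded_iff by blast
    moreover have "closed (- (?f -` V))"
      using open_vimage[OF \<open>open V\<close> cont] by (simp add: closed_Compl)
    moreover have "x \<in> stereographic -` V \<longleftrightarrow> x \<in> insert None (Some ` (UNIV - - (?f -` V)))" for x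
      using True by (cases x) auto
    then have "stereographic -` V = insert None (Some ` (UNIV - - (?f -` V)))"
      by blast
    ultimately show ?thesis
      unfolding riemann_sphere_def openin_Alexandroff_compactification
      by (intro disjI2 exI[of _ "- (?f -` V)"]) (simp add: compact_eq_bounded_closed)
  qed
  then show ?thesis
    by (simp add: continuous_map_def vimage_def)
qed

theorem embedding_map_stereographic: "embedding_map riemann_sphere euclidean stereographic"
proof -
  have "compact_space riemann_sphere"
    by (simp add: riemann_sphere_def compact_space_Alexandroff_compactification)
  then have "closed_map riemann_sphere (euclidean :: (complex \<times> real) topology) stereographic"
    by (intro continuous_imp_closed_map continuous_map_stereographic Hausdorff_space_euclidean)
  then show ?thesis
    using inj_stereographic
    by (intro injective_closed_imp_embedding_map continuous_map_stereographic) auto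
qed


section \<open>Julia sets and Multibrot sets\<close>

text \<open>
  Normality on \<open>U\<close>: every sequence in the family has a subsequence that converges locally
  uniformly on \<open>U\<close> (equivalently, uniformly on compact subsets) in the chordal metric. The value
  at infinity is allowed for the limit.
\<close>

definition normal_family ::
    "complex option set \<Rightarrow> (complex option \<Rightarrow> complex option) set \<Rightarrow> bool" where
  "normal_family U F \<longleftrightarrow>
     (\<forall>f :: nat \<Rightarrow> complex option \<Rightarrow> complex option. range f \<subseteq> F \<longrightarrow>
        (\<exists>r g. strict_mono r \<and>
           (\<forall>K. compactin riemann_sphere K \<and> K \<subseteq> U \<longrightarrow>
              uniform_limit K (\<lambda>n x. stereographic (f (r n) x)) (\<lambda>x. stereographic (g x)) sequentially)))"

text \<open>The extension of a (non-constant) polynomial to the sphere fixes infinity.\<close>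

definition sphere_poly :: "complex poly \<Rightarrow> complex option \<Rightarrow> complex option" where
  "sphere_poly P = map_option (poly P)"

definition julia_set :: "complex poly \<Rightarrow> complex option set" where
  "julia_set P =
     {z. \<forall>U. openin riemann_sphere U \<and> z \<in> U \<longrightarrow> \<not> normal_family U (range (\<lambda>n. sphere_poly P ^^ n))}"

definition multibrot :: "nat \<Rightarrow> complex set" where
  "multibrot d = {c. connectedin riemann_sphere (julia_set (monom 1 d + [:c:]))}"


section \<open>Conformal maps between open subsets of the sphere\<close>

definition sphere_inverse :: "complex option \<Rightarrow> complex option" where
  "sphere_inverse x = (case x of
      None \<Rightarrow> Some 0
    | Some z \<Rightarrow> if z = 0 then None else Some (inverse z))"

text \<open>
  Holomorphy with respect to the atlas of the sphere given by the charts \<open>z\<close> and \<open>1/z\<close>: here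
  \<open>\<sigma> \<circ> Some\<close> is the inverse of a chart around the argument, and \<open>the \<circ> \<tau>\<close> is a chart around
  the value.
\<close>

definition sphere_holomorphic_on ::
    "(complex option \<Rightarrow> complex option) \<Rightarrow> complex option set \<Rightarrow> bool" where
  "sphere_holomorphic_on f U \<longleftrightarrow>
     continuous_map (subtopology riemann_sphere U) riemann_sphere f \<and>
     (\<forall>\<sigma>\<in>{id, sphere_inverse}. \<forall>\<tau>\<in>{id, sphere_inverse}.
        (\<lambda>z. the (\<tau> (f (\<sigma> (Some z))))) holomorphic_on {z. \<sigma> (Some z) \<in> U \<and> \<tau> (f (\<sigma> (Some z))) \<noteq> None})"

definition conformal_homeomorphism ::
    "complex option set \<Rightarrow> complex option set \<Rightarrow>
     (complex option \<Rightarrow> complex option) \<Rightarrow> (complex option \<Rightarrow> complex option) \<Rightarrow> bool" where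
  "conformal_homeomorphism U V f g \<longleftrightarrow>
     homeomorphic_maps (subtopology riemann_sphere U) (subtopology riemann_sphere V) f g \<and>
     sphere_holomorphic_on f U \<and> sphere_holomorphic_on g V"

definition exterior_disk :: "complex option set" where
  "exterior_disk = insert None (Some ` {z. cmod z > 1})"

text \<open>
  \<open>\<Phi>\<close> is the normalized conformal map from the complement of the Multibrot set onto the exterior
  disk, and \<open>\<Psi>\<close> is its inverse. The normalization does not depend on the value of \<^term>\<open>the\<close> at
  infinity, as the injective map \<open>\<Phi>\<close> attains infinity at most once.
\<close>

definition multibrot_uniformization ::
    "nat \<Rightarrow> (complex option \<Rightarrow> complex option) \<Rightarrow> (complex option \<Rightarrow> complex option) \<Rightarrow> bool" where
  "multibrot_uniformization d \<Phi> \<Psi> \<longleftrightarrow>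
     conformal_homeomorphism (UNIV - Some ` multibrot d) exterior_disk \<Phi> \<Psi> \<and>
     ((\<lambda>z. the (\<Phi> (Some z)) / z) \<longlongrightarrow> 1) at_infinity"

text \<open>
  The normalization forces \<open>\<Psi>\<close> to map infinity to infinity, so that \<open>\<Psi>\<close> is finite at every
  finite point of the exterior disk.
\<close>

definition laurent_coeffs_at_infinity ::
    "(complex option \<Rightarrow> complex option) \<Rightarrow> (nat \<Rightarrow> complex) \<Rightarrow> bool" where
  "laurent_coeffs_at_infinity \<Psi> b \<longleftrightarrow>
     (\<forall>z. cmod z > 1 \<longrightarrow> (\<lambda>m. b m / z ^ m) sums (the (\<Psi> (Some z)) - z))"


section \<open>The \<open>p\<close>-adic valuation\<close>

definition padic_valuation :: "nat \<Rightarrow> rat \<Rightarrow> ereal" where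
  "padic_valuation p x =
     (if x = 0 then \<infinity>
      else ereal (of_int (THE v :: int. \<exists>r q :: int. \<not> int p dvd r \<and> \<not> int p dvd q \<and>
             x = of_nat p powi v * of_int r / of_int q)))"

end

theory Submission
  imports Defs
begin

text \<open>
  Write \<open>Q\<^sub>0 = c\<close> and \<open>Q\<^sub>k\<^sub>+\<^sub>1 = Q\<^sub>k ^ d + c\<close> for the critical orbit as a polynomial in the parameter.
  The coefficients of the uniformization \<open>\<Psi>\<close> are determined by the fact that
  \<open>Q\<^sub>n (\<Psi> w) = w ^ d\<^sup>n (1 + O (w powr (1 - d\<^sup>n\<^sup>+\<^sup>1)))\<close> for every \<open>n\<close>, and their denominators can then be
  read off from the \<open>d\<^sup>n\<close>-th root of \<open>Q\<^sub>n\<close>.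

  The asymptotic relation rests on one implication of the dynamical description of the
  Multibrot set: if the orbit of the critical point stays bounded, then the Julia set is connected
  (\<open>bounded_critical_orbit_imp_multibrot\<close>), so every point \<open>\<Psi> w\<close> is a parameter with escaping
  critical orbit. The function \<open>h\<^sub>n (x) = x ^ d\<^sup>n Q\<^sub>n (\<Psi> (1/x))\<close> is therefore a zero-free holomorphic function on
  the unit disk with \<open>h\<^sub>n (0) = 1\<close>, and on a circle of radius \<open>\<rho> < 1\<close> it is eventually bounded below by
  \<open>\<rho> ^ d\<^sup>n\<close>. So the real part of \<open>log h\<^sub>n / d\<^sup>n\<close> is at least \<open>log \<rho>\<close>, and an estimate of
  Borel-Caratheodory type makes its Taylor coefficients small. But these coefficients do not depend
  on \<open>n\<close> once \<open>n\<close> is large, because \<open>h\<^sub>n\<^sub>+\<^sub>1\<close> and \<open>h\<^sub>n ^ d\<close> agree to the order \<open>d\<^sup>n\<^sup>+\<^sup>1 - 1\<close>; letting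
  \<open>\<rho>\<close> tend to \<open>1\<close> shows that they vanish (\<open>crit_laurent_near_1\<close>).

  For the arithmetic, put \<open>x = c powr (-(d - 1))\<close>. Then \<open>Q\<^sub>k = c ^ d\<^sup>k q\<^sub>k (x)\<close> with polynomials \<open>q\<^sub>k\<close> that have
  integer coefficients, \<open>q\<^sub>0 = 1\<close> and \<open>q\<^sub>k\<^sub>+\<^sub>1 = q\<^sub>k ^ d + x ^ (1 + d + \<dots> + d\<^sup>k)\<close>. Lagrange inversion
  (\<open>lagrange_coeff\<close>) gives \<open>b m = - y\<^sub>a\<close>, where \<open>1 + m y\<close> is the power series \<open>q\<^sub>n (x) powr (m / d\<^sup>n)\<close>; the series
  \<open>y\<close> is characterized by \<open>y' = l (1 + m y)\<close>, with \<open>l\<close> the logarithmic derivative of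
  \<open>q\<^sub>n powr (1 / d\<^sup>n)\<close>, which also covers \<open>m = 0\<close>. The leading part \<open>q\<^sub>1 = 1 + x\<close> alone contributes
  \<open>y\<^sub>a = (m - d) (m - 2 d) \<dots> (m - (a - 1) d) / (d\<^sup>a a!)\<close>. All the further steps change
  \<open>l\<close> by \<open>d powr (-(k + 1))\<close> times an integral series that starts so late (\<open>1 + d + \<dots> + d\<^sup>k > k + 1\<close>)
  that, after multiplication by \<open>p ^ (t n) n!\<close>, the recursion for the coefficients of \<open>y\<close> is integral
  and unchanged modulo \<open>p\<close> (\<open>scaled_solution_cong\<close>). Hence \<open>p ^ (t a) a! b m\<close> is \<open>p\<close>-integral, and it is a unit
  if and only if the product \<open>(m - d) \<dots> (m - (a - 1) d)\<close> is prime to \<open>p\<close>, that is, if and only if \<open>p\<close> does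
  not divide \<open>m\<close> or the product is empty (\<open>a = 1\<close>, \<open>m = d - 2\<close>).
\<close>

section \<open>Orbits of unicritical polynomials\<close>

definition unicrit :: "nat \<Rightarrow> complex \<Rightarrow> complex \<Rightarrow> complex" where
  "unicrit d c z = z ^ d + c"

lemma holomorphic_on_unicrit_funpow: "(unicrit d c ^^ n) holomorphic_on S"
proof (induction n)
  case (Suc n)
  have "(\<lambda>z. (unicrit d c ^^ n) z ^ d + c) holomorphic_on S"
    using Suc by (intro holomorphic_intros) auto
  then show ?case
    by (simp add: unicrit_def[of d c "(unicrit d c ^^ n) _"] o_def)
qed (simp add: id_def)

lemma continuous_on_unicrit_funpow: "continuous_on S (unicrit d c ^^ n)"
  by (rule holomorphic_on_imp_continuous_on[OF holomorphic_on_unicrit_funpow])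

lemma sphere_poly_unicrit_funpow:
  "(sphere_poly (monom 1 d + [:c:]) ^^ n) x = map_option (unicrit d c ^^ n) x"
proof (induction n)
  case (Suc n)
  then show ?case
    by (cases x) (simp_all add: sphere_poly_def poly_monom unicrit_def)
qed (cases x; simp)

lemma unicrit_escape_step:
  assumes "d \<ge> 2" "cmod z \<ge> cmod c + 3"
  shows "cmod (unicrit d c z) \<ge> 2 * cmod z"
proof -
  have "1 \<le> cmod z" using assms(2) norm_ge_zero[of c] by linarith
  have "(cmod c + 3) * cmod z \<le> cmod z * cmod z"
    using assms(2) by (intro mult_right_mono) auto
  also have "\<dots> = cmod z ^ 2" by (simp add: power2_eq_square)
  also have "\<dots> \<le> cmod z ^ d"
    using \<open>1 \<le> cmod z\<close> assms(1) by (intro power_increasing) auto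
  finally have 1: "(cmod c + 3) * cmod z \<le> cmod (z ^ d)" by (simp add: norm_power)
  have 2: "cmod c * 1 \<le> cmod c * cmod z" using \<open>1 \<le> cmod z\<close> by (intro mult_left_mono) auto
  have "cmod (z ^ d) \<le> cmod (z ^ d + c) + cmod c"
    using norm_triangle_ineq4[of "z ^ d + c" c] by simp
  then show ?thesis using 1 2 \<open>1 \<le> cmod z\<close> by (simp add: unicrit_def algebra_simps)
qed

lemma unicrit_escape:
  assumes "d \<ge> 2" "cmod ((unicrit d c ^^ n) z) \<ge> cmod c + 3"
  shows "cmod ((unicrit d c ^^ (n + k)) z) \<ge> 2 ^ k * cmod ((unicrit d c ^^ n) z)"
proof (induction k)
  case (Suc k)
  let ?w = "(unicrit d c ^^ n) z" and ?u = "(unicrit d c ^^ (n + k)) z"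
  have "cmod ?w \<le> 2 ^ k * cmod ?w"
    using mult_right_mono[of 1 "2 ^ k" "cmod ?w"] by simp
  with assms(2) Suc have "cmod ?u \<ge> cmod c + 3" by linarith
  then have "2 * cmod ?u \<le> cmod (unicrit d c ?u)" by (rule unicrit_escape_step[OF assms(1)])
  with Suc show ?case by simp
qed simp

text \<open>
  The radius \<open>\<bar>c\<bar> + 3\<close> is chosen such that one step outside of this disk at least doubles the modulus.
  Thus an orbit is unbounded as soon as it leaves the disk, and the level sets decrease to the
  filled Julia set.
\<close>
definition level_set :: "nat \<Rightarrow> complex \<Rightarrow> nat \<Rightarrow> complex set" where
  "level_set d c n = {z. cmod ((unicrit d c ^^ n) z) \<le> cmod c + 3}"

definition filled_julia :: "nat \<Rightarrow> complex \<Rightarrow> complex set" where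
  "filled_julia d c = (\<Inter>n. level_set d c n)"

lemma level_set_mono:
  assumes "d \<ge> 2" "n \<le> k"
  shows "level_set d c k \<subseteq> level_set d c n"
proof (rule ccontr)
  assume "\<not> level_set d c k \<subseteq> level_set d c n"
  then obtain z where z: "cmod ((unicrit d c ^^ k) z) \<le> cmod c + 3"
    "cmod ((unicrit d c ^^ n) z) > cmod c + 3"
    unfolding level_set_def subset_iff mem_Collect_eq by (meson not_le)
  let ?w = "(unicrit d c ^^ n) z"
  have "cmod ?w \<le> 2 ^ (k - n) * cmod ?w"
    using mult_right_mono[of 1 "2 ^ (k - n)" "cmod ?w"] by simp
  then show False
    using unicrit_escape[of d c n z "k - n"] assms z by simp
qed

lemma level_set_0: "level_set d c 0 = cball 0 (cmod c + 3)"
  by (auto simp: level_set_def)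

lemma closed_level_set: "closed (level_set d c n)"
proof -
  have "level_set d c n = (unicrit d c ^^ n) -` cball 0 (cmod c + 3)"
    by (auto simp: level_set_def)
  then show ?thesis
    by (metis closed_vimage closed_cball continuous_on_unicrit_funpow)
qed

lemma compact_level_set:
  assumes "d \<ge> 2"
  shows "compact (level_set d c n)"
  using level_set_mono[OF assms, of 0 n] closed_level_set
  by (metis bounded_cball bounded_subset compact_eq_bounded_closed level_set_0 le0)

text \<open>
  The map is open and proper, so a nonempty clopen part of the preimage of a connected set \<open>E\<close>
  is mapped onto \<open>E\<close>. If \<open>E\<close> contains the critical value, each such part must contain
  the only preimage \<open>0\<close> of \<open>c\<close>; two disjoint parts are impossible.
\<close>
lemma connected_vimage_unicrit:
  assumes d: "d \<ge> 2" and E: "compact E" "connected E" "c \<in> E"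
    and comp: "compact (unicrit d c -` E)"
  shows "connected (unicrit d c -` E)"
proof (rule ccontr)
  let ?f = "unicrit d c"
  have hol: "?f holomorphic_on UNIV"
    using holomorphic_on_unicrit_funpow[of 1 d c] by simp
  have nonconst: "\<not> ?f constant_on UNIV"
  proof
    assume "?f constant_on UNIV"
    then have "?f 0 = ?f 1" by (auto simp: constant_on_def)
    then show False using d by (simp add: unicrit_def power_0_left)
  qed
  have opn: "open (?f ` U)" if "open U" for U
    by (rule open_mapping_thm[OF hol]) (use that nonconst in auto)
  assume "\<not> connected (?f -` E)"
  then obtain A B where AB: "closed A" "closed B" "?f -` E \<subseteq> A \<union> B" "A \<inter> B \<inter> ?f -` E = {}"
      "A \<inter> ?f -` E \<noteq> {}" "B \<inter> ?f -` E \<noteq> {}"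
    unfolding connected_closed by blast
  have onto: "?f ` (A \<inter> ?f -` E) = E"
    if AB: "closed A" "closed B" "?f -` E \<subseteq> A \<union> B" "A \<inter> B \<inter> ?f -` E = {}" "A \<inter> ?f -` E \<noteq> {}" for A B
  proof -
    have "compact (A \<inter> ?f -` E)" using comp AB(1) by (simp add: closed_Int_compact)
    moreover have "continuous_on (A \<inter> ?f -` E) ?f"
      using continuous_on_unicrit_funpow[of _ 1 d c] by simp
    ultimately have "closed (?f ` (A \<inter> ?f -` E))"
      by (intro compact_imp_closed compact_continuous_image)
    then have "closedin (top_of_set E) (?f ` (A \<inter> ?f -` E))"
      by (intro closed_subset) auto
    moreover have "?f ` (A \<inter> ?f -` E) = E \<inter> ?f ` (- B)"
    proof (intro equalityI subsetI)
      fix y assume "y \<in> ?f ` (A \<inter> ?f -` E)"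
      then show "y \<in> E \<inter> ?f ` (- B)" using AB(4) by blast
    next
      fix y assume "y \<in> E \<inter> ?f ` (- B)"
      then show "y \<in> ?f ` (A \<inter> ?f -` E)" using AB(3) by blast
    qed
    then have "openin (top_of_set E) (?f ` (A \<inter> ?f -` E))"
      using opn[of "- B"] AB(2) by (simp add: openin_open_Int open_Compl)
    ultimately show ?thesis
      using E(2) AB(5) unfolding connected_clopen by (metis image_is_empty)
  qed
  have "z = 0" if "?f z = c" for z
    using that d by (simp add: unicrit_def)
  then have "0 \<in> X" if "c \<in> ?f ` X" for X
    using that by (metis imageE)
  moreover have "c \<in> ?f ` (A \<inter> ?f -` E)" "c \<in> ?f ` (B \<inter> ?f -` E)"
    using onto[OF AB(1-5)] onto[OF AB(2,1) _ _ AB(6)] AB(3,4) E(3) by (simp_all add: Un_commute Int_commute)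
  ultimately have "0 \<in> A \<inter> B \<inter> ?f -` E" by (meson IntD1 IntD2 IntI)
  then show False using AB(4) by simp
qed

lemma connected_level_set:
  assumes d: "d \<ge> 2" and bdd: "\<And>n. cmod ((unicrit d c ^^ n) c) \<le> cmod c + 3"
  shows "connected (level_set d c n)"
proof (induction n)
  case 0
  then show ?case by (simp add: level_set_0)
next
  case (Suc n)
  have *: "level_set d c (Suc n) = unicrit d c -` level_set d c n"
    by (simp add: level_set_def vimage_def funpow_swap1)
  show ?case
    unfolding *
  proof (rule connected_vimage_unicrit[OF d compact_level_set[OF d] Suc])
    show "c \<in> level_set d c n" using bdd by (simp add: level_set_def)
    show "compact (unicrit d c -` level_set d c n)"
      using compact_level_set[OF d, of c "Suc n"] by (simp add: *)
  qed
qed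

lemma connected_filled_julia:
  assumes d: "d \<ge> 2" and bdd: "\<And>n. cmod ((unicrit d c ^^ n) c) \<le> cmod c + 3"
  shows "connected (filled_julia d c)"
  unfolding filled_julia_def
  using connected_nest[of "level_set d c", OF compact_level_set[OF d] connected_level_set[OF d bdd]]
    level_set_mono[OF d] by blast

lemma closed_filled_julia: "closed (filled_julia d c)"
  unfolding filled_julia_def by (intro closed_INT ballI closed_level_set)

lemma bounded_filled_julia: "bounded (filled_julia d c)"
proof (rule bounded_subset)
  show "filled_julia d c \<subseteq> cball 0 (cmod c + 3)"
    unfolding filled_julia_def level_set_0[of d c, symmetric] by blast
qed simp

text \<open>
  By the maximum principle the iterates would stay bounded on a bounded component of the complement,
  as they do on its boundary.
\<close>
lemma connected_Compl_filled_julia: "connected (- filled_julia d c)"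
proof (rule ccontr)
  assume "\<not> connected (- filled_julia d c)"
  then obtain C where C: "C \<in> components (- filled_julia d c)" "bounded C"
    using cobounded_has_bounded_component[of "- filled_julia d c"] bounded_filled_julia by auto
  have fr: "frontier C \<subseteq> filled_julia d c"
    by (rule frontier_of_components_closed_complement[OF closed_filled_julia C(1)])
  obtain z where z: "z \<in> C" using in_components_nonempty[OF C(1)] by blast
  have "cmod ((unicrit d c ^^ n) w) \<le> cmod c + 3" if "w \<in> frontier C" for n w
    using fr that by (auto simp: filled_julia_def level_set_def)
  then have "cmod ((unicrit d c ^^ n) z) \<le> cmod c + 3" for n
    by (rule maximum_modulus_frontier[OF holomorphic_on_unicrit_funpow continuous_on_unicrit_funpow C(2) _ z])
  then have "z \<in> filled_julia d c" by (auto simp: filled_julia_def level_set_def)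
  then show False using z in_components_subset[OF C(1)] by auto
qed

lemma connected_frontier_filled_julia:
  assumes d: "d \<ge> 2" and bdd: "\<And>n. cmod ((unicrit d c ^^ n) c) \<le> cmod c + 3"
  shows "connected (frontier (filled_julia d c))"
  using connected_filled_julia[OF assms] connected_Compl_filled_julia by (rule connected_frontier_simple)

section \<open>The Julia set is the boundary of the filled Julia set\<close>

lemma dist_stereographic_infinity:
  assumes "cmod z \<ge> 1"
  shows "dist (stereographic (Some z)) (stereographic None) \<le> 4 / cmod z"
proof -
  have pos: "(cmod z)\<^sup>2 + 1 > 0" by (simp add: add_nonneg_pos)
  have eq: "stereographic (Some z) - stereographic None = ((2 / ((cmod z)\<^sup>2 + 1)) *\<^sub>R z, - (2 / ((cmod z)\<^sup>2 + 1)))"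
    unfolding stereographic_Some by (simp add: stereographic_def)
  have "dist (stereographic (Some z)) (stereographic None) \<le>
      cmod ((2 / ((cmod z)\<^sup>2 + 1)) *\<^sub>R z) + norm (- (2 / ((cmod z)\<^sup>2 + 1)))"
    unfolding dist_norm eq by (rule norm_Pair_le)
  also have "\<dots> = (2 * cmod z + 2) / ((cmod z)\<^sup>2 + 1)"
    using pos by (simp add: add_divide_distrib)
  also have "\<dots> \<le> (4 * cmod z) / ((cmod z)\<^sup>2)"
    using assms pos by (intro frac_le) auto
  also have "\<dots> = 4 / cmod z" using assms by (simp add: power2_eq_square)
  finally show ?thesis .
qed

lemma snd_stereographic_Some: "snd (stereographic (Some z)) = 1 - 2 / ((cmod z)\<^sup>2 + 1)"
  by (simp add: stereographic_Some)

lemma continuous_on_stereographic_Some: "continuous_on S (\<lambda>z. stereographic (Some z))"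
proof -
  have nz: "(cmod z)\<^sup>2 + 1 \<noteq> 0" for z
    using zero_le_power2[of "cmod z"] by linarith
  show ?thesis
    unfolding stereographic_Some using nz by (intro continuous_intros) auto
qed

lemma nat_seq_constant_or_at_top:
  fixes k :: "nat \<Rightarrow> nat"
  obtains r :: "nat \<Rightarrow> nat" and j where "strict_mono r" "\<And>n. k (r n) = j"
  | "filterlim k at_top sequentially"
proof (cases "\<exists>B. infinite {n. k n \<le> B}")
  case True
  then obtain B where "infinite {n. k n \<le> B}" by blast
  moreover have "{n. k n \<le> B} = (\<Union>j\<le>B. {n. k n = j})" by auto
  ultimately have "infinite (\<Union>j\<le>B. {n. k n = j})" by simp
  then obtain j where "infinite {n. k n = j}" by blast
  then obtain r :: "nat \<Rightarrow> nat" where "strict_mono r" "\<And>n. r n \<in> {n. k n = j}"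
    using infinite_enumerate by blast
  then show ?thesis by (intro that(1)[of r j]) auto
next
  case False
  have "eventually (\<lambda>n. B \<le> k n) sequentially" for B
  proof -
    have "finite {n. \<not> B \<le> k n}"
      using False by (auto intro: finite_subset[of _ "{n. k n \<le> B}"])
    then show ?thesis 
      unfolding cofinite_eq_sequentially[symmetric] eventually_cofinite .
  qed
  then show ?thesis using that(2) by (simp add: filterlim_at_top)
qed

lemma openin_sphere_vimage_Some:
  assumes "openin riemann_sphere U"
  shows "open (Some -` U)"
  using openin_continuous_map_preimage[OF continuous_map_Some[of euclidean] assms[unfolded riemann_sphere_def]]
  by (simp add: vimage_def)

lemma compactin_sphere_Some_image:
  "compact K \<Longrightarrow> compactin riemann_sphere (Some ` K)"
  unfolding riemann_sphere_def using image_compactin[OF _ continuous_map_Some] by (metis compactin_euclidean_iff)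

lemma compactin_sphere_Some_imageD:
  "compactin riemann_sphere (Some ` K) \<Longrightarrow> compact K"
proof -
  assume K: "compactin riemann_sphere (Some ` K)"
  have "Hausdorff_space riemann_sphere"
    by (simp add: riemann_sphere_def Hausdorff_space_Alexandroff_compactification
        locally_compact_space_euclidean)
  then have "closedin riemann_sphere (Some ` K)"
    using K by (rule compactin_imp_closedin)
  then show "compact K"
    by (simp add: riemann_sphere_def)
qed

text \<open>
  A sequence of iterates either repeats one iterate infinitely often, or its exponents tend to
  infinity; in the second case it converges to infinity, uniformly on each compact subset, as
  such a subset is disjoint from one of the level sets.
\<close>
lemma normal_family_basin:
  assumes d: "d \<ge> 2"
  shows "normal_family (insert None (Some ` (- filled_julia d c))) (range (\<lambda>n. sphere_poly (monom 1 d + [:c:]) ^^ n))"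
    (is "normal_family ?U (range ?F)")
  unfolding normal_family_def
proof (intro allI impI)
  fix f :: "nat \<Rightarrow> complex option \<Rightarrow> complex option"
  assume "range f \<subseteq> range ?F"
  then have "f n \<in> range ?F" for n by blast
  then have "\<forall>n. \<exists>k. f n = ?F k" by (simp add: image_iff)
  then obtain k where k: "\<And>n. f n = ?F (k n)" by metis
  show "\<exists>r g. strict_mono r \<and> (\<forall>K. compactin riemann_sphere K \<and> K \<subseteq> ?U \<longrightarrow>
      uniform_limit K (\<lambda>n x. stereographic (f (r n) x)) (\<lambda>x. stereographic (g x)) sequentially)"
  proof (rule nat_seq_constant_or_at_top[of k])
    fix r :: "nat \<Rightarrow> nat" and j assume r: "strict_mono r" "\<And>n. k (r n) = j"
    show ?thesis
      by (rule exI[of _ r], rule exI[of _ "?F j"]) (use r k in \<open>auto intro: uniform_limit_const\<close>)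
  next
    assume top: "filterlim k at_top sequentially"
    have "uniform_limit K (\<lambda>n x. stereographic (f n x)) (\<lambda>x. stereographic None) sequentially"
      if K: "compactin riemann_sphere K" "K \<subseteq> ?U" for K
    proof (rule uniform_limitI)
      fix e :: real assume e: "e > 0"
      let ?V = "\<lambda>n. insert None (Some ` (- level_set d c n))"
      have "\<exists>\<F>. finite \<F> \<and> \<F> \<subseteq> range ?V \<and> K \<subseteq> \<Union>\<F>"
      proof (rule compactinD[OF K(1)])
        show "openin riemann_sphere V" if "V \<in> range ?V" for V
        proof -
          from that obtain n where "V = insert None (Some ` (UNIV - level_set d c n))"
            by (auto simp: Compl_eq_Diff_UNIV)
          then show ?thesis
            unfolding riemann_sphere_def openin_Alexandroff_compactification
            using compact_level_set[OF d, of c n] closed_level_set[of d c n]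
            by (intro disjI2 exI[of _ "level_set d c n"]) simp
        qed
        show "K \<subseteq> \<Union> (range ?V)"
          using K(2) by (auto simp: filled_julia_def)
      qed
      then obtain I where I: "finite I" "K \<subseteq> (\<Union>n\<in>I. ?V n)"
        by (metis (no_types, lifting) finite_subset_image)
      define N where "N = Max (insert 0 I)"
      have KN: "K \<subseteq> ?V N"
      proof
        fix x assume "x \<in> K"
        then obtain n where n: "n \<in> I" "x \<in> ?V n" using I(2) by blast
        then have "n \<le> N" using I(1) by (simp add: N_def)
        then show "x \<in> ?V N" using n(2) level_set_mono[OF d, of n N c] by auto
      qed
      obtain j where j: "(4 / e) < 2 ^ j"
        using real_arch_pow[of 2 "4 / e"] by auto
      have near: "dist (stereographic (?F n x)) (stereographic None) < e"
        if n: "n \<ge> N + j" and x: "x \<in> K" for n x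
      proof (cases x)
        case None
        then show ?thesis using e by (simp add: sphere_poly_unicrit_funpow)
      next
        case (Some z)
        let ?w = "(unicrit d c ^^ N) z"
        have w: "cmod ?w > cmod c + 3"
          using KN x Some by (auto simp: level_set_def)
        have w1: "cmod ?w \<ge> 1" using w norm_ge_zero[of c] by linarith
        have "(2::real) ^ j \<le> 2 ^ (n - N)"
          using n by (intro power_increasing) auto
        also have "\<dots> \<le> 2 ^ (n - N) * cmod ?w"
          using mult_left_mono[OF w1, of "2 ^ (n - N)"] by simp
        also have "\<dots> \<le> cmod ((unicrit d c ^^ n) z)"
          using unicrit_escape[OF d, of c N z "n - N"] w n by simp
        finally have big: "2 ^ j \<le> cmod ((unicrit d c ^^ n) z)" .
        have "1 \<le> (2::real) ^ j" by simp
        with big have "1 \<le> cmod ((unicrit d c ^^ n) z)" by linarith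
        then have "dist (stereographic (?F n x)) (stereographic None) \<le> 4 / cmod ((unicrit d c ^^ n) z)"
          unfolding Some using dist_stereographic_infinity[of "(unicrit d c ^^ n) z"]
          by (simp add: sphere_poly_unicrit_funpow)
        also have "\<dots> < e"
        proof -
          have "4 < e * 2 ^ j" using j e by (simp add: divide_less_eq mult.commute)
          also have "\<dots> \<le> e * cmod ((unicrit d c ^^ n) z)" using big e by (intro mult_left_mono) auto
          finally show ?thesis
            using big \<open>1 \<le> (2::real) ^ j\<close> by (subst divide_less_eq) (auto simp: mult.commute)
        qed
        finally show ?thesis .
      qed
      have "eventually (\<lambda>n. k n \<ge> N + j) sequentially"
        using top by (simp add: filterlim_at_top)
      then show "\<forall>\<^sub>F n in sequentially. \<forall>x\<in>K. dist (stereographic (f n x)) (stereographic None) < e"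
        by eventually_elim (use near k in auto)
    qed
    then show ?thesis
      by (intro exI[of _ id] exI[of _ "\<lambda>_. None"]) (auto simp: strict_mono_def)
  qed
qed

lemma normal_family_interior:
  "normal_family (Some ` interior (filled_julia d c)) (range (\<lambda>n. sphere_poly (monom 1 d + [:c:]) ^^ n))"
    (is "normal_family ?U (range ?F)")
  unfolding normal_family_def
proof (intro allI impI)
  fix f :: "nat \<Rightarrow> complex option \<Rightarrow> complex option"
  assume "range f \<subseteq> range ?F"
  then have "f n \<in> range ?F" for n by blast
  then have "\<forall>n. \<exists>k. f n = ?F k" by (simp add: image_iff)
  then obtain k where k: "\<And>n. f n = ?F (k n)" by metis
  let ?S = "interior (filled_julia d c)" and ?R = "cmod c + 3"
  have bound: "cmod ((unicrit d c ^^ n) z) \<le> ?R" if "z \<in> ?S" for n z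
    using that interior_subset by (fastforce simp: filled_julia_def level_set_def)
  obtain g r where g: "strict_mono r"
      "\<And>x. x \<in> ?S \<Longrightarrow> (\<lambda>n. (unicrit d c ^^ k (r n)) x) \<longlonglongrightarrow> g x"
      "\<And>K. compact K \<Longrightarrow> K \<subseteq> ?S \<Longrightarrow> uniform_limit K ((\<lambda>n. unicrit d c ^^ k n) \<circ> r) g sequentially"
  proof (rule Montel[of ?S "range (\<lambda>n. unicrit d c ^^ n)" "\<lambda>n. unicrit d c ^^ k n"])
    show "\<exists>B. \<forall>h\<in>range (\<lambda>n. unicrit d c ^^ n). \<forall>z\<in>K. cmod (h z) \<le> B" if "K \<subseteq> ?S" for K
      using bound that by (intro exI[of _ ?R]) auto
  qed (auto intro: holomorphic_on_unicrit_funpow)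
  show "\<exists>r g. strict_mono r \<and> (\<forall>K. compactin riemann_sphere K \<and> K \<subseteq> ?U \<longrightarrow>
      uniform_limit K (\<lambda>n x. stereographic (f (r n) x)) (\<lambda>x. stereographic (g x)) sequentially)"
  proof (intro exI conjI allI impI)
    fix K assume K: "compactin riemann_sphere K \<and> K \<subseteq> ?U"
    then obtain K' where K': "K = Some ` K'" "K' \<subseteq> ?S" by (meson subset_imageE)
    have "compact K'" using K K'(1) compactin_sphere_Some_imageD by blast
    then have "uniform_limit K' (\<lambda>n. unicrit d c ^^ k (r n)) g sequentially"
      using g(3)[OF _ K'(2)] by (simp add: o_def)
    then have "uniform_limit K' (\<lambda>n x. stereographic (Some ((unicrit d c ^^ k (r n)) x)))
        (\<lambda>x. stereographic (Some (g x))) sequentially"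
    proof (rule uniform_limit_compose_uniformly_continuous_on[where B = "cball 0 ?R" and f = "\<lambda>z. stereographic (Some z)"])
      show "uniformly_continuous_on (cball 0 ?R) (\<lambda>z. stereographic (Some z))"
        by (intro compact_uniformly_continuous continuous_on_stereographic_Some compact_cball)
      show "\<forall>\<^sub>F n in sequentially. \<forall>x\<in>K'. (unicrit d c ^^ k (r n)) x \<in> cball 0 ?R"
        using bound K'(2) by (intro always_eventually) auto
    qed auto
    then show "uniform_limit K (\<lambda>n x. stereographic (f (r n) x)) (\<lambda>x. stereographic (map_option g x)) sequentially"
      unfolding uniform_limit_iff K'(1) by (simp add: k sphere_poly_unicrit_funpow)
  qed (rule g(1))
qed

text \<open>
  Near a boundary point, a locally uniform limit would be finite at the point itself and
  infinite at the escaping points that accumulate there. The last coordinate of the stereographic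
  image detects this: it is \<open>1\<close> exactly at infinity.
\<close>
lemma not_normal_family_frontier:
  assumes d: "d \<ge> 2" and z: "z \<in> frontier (filled_julia d c)"
    and U: "openin riemann_sphere U" "Some z \<in> U"
  shows "\<not> normal_family U (range (\<lambda>n. sphere_poly (monom 1 d + [:c:]) ^^ n))"
    (is "\<not> normal_family U (range ?F)")
proof
  let ?R = "cmod c + 3"
  assume "normal_family U (range ?F)"
  from this[unfolded normal_family_def, rule_format, of "\<lambda>n. ?F n"]
  obtain r g where r: "strict_mono r" and lim: "\<And>K. compactin riemann_sphere K \<Longrightarrow> K \<subseteq> U \<Longrightarrow>
      uniform_limit K (\<lambda>n x. stereographic (?F (r n) x)) (\<lambda>x. stereographic (g x)) sequentially"
    by auto
  obtain e where e: "e > 0" "cball z e \<subseteq> Some -` U"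
    using openin_sphere_vimage_Some[OF U(1)] U(2) unfolding open_contains_cball by blast
  let ?s = "\<lambda>w. stereographic (Some w)" and ?h = "\<lambda>w. stereographic (g (Some w))"
  have ul: "uniform_limit (cball z e) (\<lambda>n w. ?s ((unicrit d c ^^ r n) w)) ?h sequentially"
    using lim[OF compactin_sphere_Some_image[OF compact_cball], of z e] e(2)
    by (auto simp: uniform_limit_iff sphere_poly_unicrit_funpow image_subset_iff_subset_vimage)
  have cont: "continuous_on (cball z e) ?h"
  proof (rule uniform_limit_theorem[OF _ ul])
    show "\<forall>\<^sub>F n in sequentially. continuous_on (cball z e) (\<lambda>w. ?s ((unicrit d c ^^ r n) w))"
      by (intro always_eventually allI continuous_on_compose2[OF continuous_on_stereographic_Some[of UNIV] continuous_on_unicrit_funpow]) auto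
  qed simp
  have pt: "(\<lambda>n. snd (?s ((unicrit d c ^^ r n) w))) \<longlonglongrightarrow> snd (?h w)" if "w \<in> cball z e" for w
    by (intro tendsto_snd tendsto_uniform_limitI[OF ul that])
  have low: "snd (?h z) \<le> 1 - 2 / (?R\<^sup>2 + 1)"
  proof (rule tendsto_upperbound[OF pt])
    have "z \<in> filled_julia d c" using z closed_filled_julia frontier_subset_closed by blast
    then have b: "cmod ((unicrit d c ^^ n) z) \<le> ?R" for n
      by (auto simp: filled_julia_def level_set_def)
    have "snd (?s w) \<le> 1 - 2 / (?R\<^sup>2 + 1)" if "cmod w \<le> ?R" for w
      unfolding snd_stereographic_Some using that
      by (intro diff_left_mono frac_le add_right_mono power_mono) (auto intro: add_nonneg_pos)
    then show "\<forall>\<^sub>F n in sequentially. snd (?s ((unicrit d c ^^ r n) z)) \<le> 1 - 2 / (?R\<^sup>2 + 1)"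
      using b by (intro always_eventually) blast
  qed (use e in auto)
  have high: "snd (?h w) = 1" if w: "w \<in> cball z e" "w \<notin> filled_julia d c" for w
  proof -
    obtain N where N: "cmod ((unicrit d c ^^ N) w) > ?R"
      using w(2) by (auto simp: filled_julia_def level_set_def not_le)
    have "filterlim (\<lambda>k. 2 ^ k * cmod ((unicrit d c ^^ N) w)) at_top sequentially"
    proof (rule filterlim_at_top_mult_tendsto_pos[OF tendsto_const])
      show "0 < cmod ((unicrit d c ^^ N) w)" using N norm_ge_zero[of c] by linarith
      show "filterlim (\<lambda>k. (2::real) ^ k) at_top sequentially"
        by (rule filterlim_at_top_mono[OF filterlim_real_sequentially])
           (auto intro!: always_eventually less_imp_le of_nat_less_two_power)
    qed
    then have "filterlim (\<lambda>k. cmod ((unicrit d c ^^ (N + k)) w)) at_top sequentially"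
      by (rule filterlim_at_top_mono)
         (use N in \<open>intro always_eventually allI unicrit_escape[OF d] less_imp_le\<close>)
    then have "filterlim (\<lambda>k. cmod ((unicrit d c ^^ (k + N)) w)) at_top sequentially"
      by (simp add: add.commute)
    then have "filterlim (\<lambda>k. cmod ((unicrit d c ^^ k) w)) at_top sequentially"
      unfolding filterlim_at_top by (subst (asm) eventually_sequentially_seg)
    then have inf: "filterlim (\<lambda>n. cmod ((unicrit d c ^^ r n) w)) at_top sequentially"
      using filterlim_compose[OF _ filterlim_subseq[OF r], of "\<lambda>k. cmod ((unicrit d c ^^ k) w)"] by simp
    have "(\<lambda>n. 1 - 2 / ((cmod ((unicrit d c ^^ r n) w))\<^sup>2 + 1)) \<longlonglongrightarrow> 1 - 0"
    proof (intro tendsto_diff tendsto_const tendsto_divide_0[OF tendsto_const] filterlim_at_top_imp_at_infinity)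
      show "filterlim (\<lambda>n. (cmod ((unicrit d c ^^ r n) w))\<^sup>2 + 1) at_top sequentially"
        unfolding add.commute[of _ 1]
        by (intro filterlim_tendsto_add_at_top[OF tendsto_const] filterlim_pow_at_top inf) simp
    qed
    then show ?thesis
      using pt[OF w(1)] unfolding snd_stereographic_Some by (simp add: LIMSEQ_unique)
  qed
  have "z \<in> closure (- filled_julia d c)" using z by (simp add: frontier_closures)
  then obtain u where u: "\<And>n. u n \<in> - filled_julia d c" "u \<longlonglongrightarrow> z"
    by (auto simp: closure_sequential)
  have ev: "\<forall>\<^sub>F n in sequentially. u n \<in> cball z e"
    using tendstoD[OF u(2) e(1)] by eventually_elim (simp add: dist_commute)
  have "(\<lambda>n. ?h (u n)) \<longlonglongrightarrow> ?h z"
    by (rule continuous_on_tendsto_compose[OF cont u(2) _ ev]) (use e in auto)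
  then have "(\<lambda>n. snd (?h (u n))) \<longlonglongrightarrow> snd (?h z)" by (rule tendsto_snd)
  moreover have "\<forall>\<^sub>F n in sequentially. snd (?h (u n)) = 1"
    using ev by eventually_elim (use u(1) high in auto)
  then have "(\<lambda>n. snd (?h (u n))) \<longlonglongrightarrow> 1" by (rule tendsto_eventually)
  ultimately have "snd (?h z) = 1" by (rule LIMSEQ_unique)
  moreover have "2 / (?R\<^sup>2 + 1) > 0" by (intro divide_pos_pos add_nonneg_pos) auto
  ultimately show False using low by linarith
qed

theorem julia_set_unicrit:
  assumes d: "d \<ge> 2"
  shows "julia_set (monom 1 d + [:c:]) = Some ` frontier (filled_julia d c)"
proof (intro equalityI subsetI)
  fix x assume "x \<in> Some ` frontier (filled_julia d c)"
  then show "x \<in> julia_set (monom 1 d + [:c:])"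
    using not_normal_family_frontier[OF d] by (auto simp: julia_set_def)
next
  fix x assume x: "x \<in> julia_set (monom 1 d + [:c:])"
  have "compactin euclidean (filled_julia d c)"
    using closed_filled_julia bounded_filled_julia by (simp add: compact_eq_bounded_closed)
  then have "openin riemann_sphere (insert None (Some ` (- filled_julia d c)))"
    unfolding riemann_sphere_def openin_Alexandroff_compactification Compl_eq_Diff_UNIV
    using closed_filled_julia by auto
  with x normal_family_basin[OF d, of c] have 1: "x \<notin> insert None (Some ` (- filled_julia d c))"
    unfolding julia_set_def by blast
  have "openin riemann_sphere (Some ` interior (filled_julia d c))"
    by (simp add: riemann_sphere_def)
  with x normal_family_interior have 2: "x \<notin> Some ` interior (filled_julia d c)"
    unfolding julia_set_def by blast
  from 1 2 show "x \<in> Some ` frontier (filled_julia d c)"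
    using closed_filled_julia[of d c] by (cases x) (auto simp: frontier_def)
qed

text \<open>
  The filled Julia set is a decreasing intersection of connected compact level sets, and its
  complement is connected too; the boundary of such a set is connected because the plane is
  unicoherent.
\<close>
theorem bounded_critical_orbit_imp_multibrot:
  assumes d: "d \<ge> 2" and bdd: "\<And>n. cmod ((unicrit d c ^^ n) c) \<le> cmod c + 3"
  shows "c \<in> multibrot d"
proof -
  have "connectedin riemann_sphere (Some ` frontier (filled_julia d c))"
    unfolding riemann_sphere_def
    by (rule connectedin_continuous_map_image[OF continuous_map_Some])
       (use connected_frontier_filled_julia[OF assms] in simp)
  then show ?thesis by (simp add: multibrot_def julia_set_unicrit[OF d])
qed

section \<open>Power series divisible by powers of the variable\<close>

lemma fps_X_power_dvd_iff: "fps_X ^ k dvd (f :: complex fps) \<longleftrightarrow> (\<forall>i<k. fps_nth f i = 0)"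
proof
  assume "\<forall>i<k. fps_nth f i = 0"
  then have "f = fps_X ^ k * fps_shift k f"
    by (auto simp: fps_eq_iff fps_X_power_mult_nth)
  then show "fps_X ^ k dvd f" by (metis dvd_triv_left)
qed (auto simp: fps_X_power_mult_nth elim!: dvdE)

lemma fps_X_power_dvd_deriv:
  "fps_X ^ Suc k dvd f \<Longrightarrow> fps_X ^ k dvd fps_deriv (f :: complex fps)"
  by (simp add: fps_X_power_dvd_iff del: power_Suc)

lemma fps_X_power_dvd_diff_1:
  assumes "fps_X ^ k dvd fps_deriv (f :: complex fps)" "fps_nth f 0 = 1"
  shows "fps_X ^ Suc k dvd f - 1"
  unfolding fps_X_power_dvd_iff
proof (intro allI impI)
  fix i assume "i < Suc k"
  show "fps_nth (f - 1) i = 0"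
  proof (cases i)
    case (Suc j)
    with assms(1) \<open>i < Suc k\<close> have "of_nat (Suc j) * fps_nth f (Suc j) = 0"
      by (auto simp: fps_X_power_dvd_iff)
    then have "fps_nth f (Suc j) = 0" by (simp del: of_nat_Suc)
    then show ?thesis by (simp add: Suc)
  qed (use assms(2) in simp)
qed

section \<open>The critical orbit at infinity\<close>

text \<open>
  The critical orbit in two guises. The polynomial \<open>Q\<^sub>k\<close> is \<open>c ^ d\<^sup>k\<close> times \<^term>\<open>crit_fps d k\<close>
  evaluated at \<open>c powr (-(d - 1))\<close>. If the parameter is substituted by a series
  \<open>c = x powr (-1) * B (x)\<close>, then \<^term>\<open>crit_laurent d B k\<close> is \<open>x ^ d\<^sup>k Q\<^sub>k (c)\<close>.
\<close>
primrec crit_fps :: "nat \<Rightarrow> nat \<Rightarrow> complex fps" where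
  "crit_fps d 0 = 1"
| "crit_fps d (Suc k) = crit_fps d k ^ d + fps_X ^ (\<Sum>i\<le>k. d ^ i)"

primrec crit_laurent :: "nat \<Rightarrow> complex fps \<Rightarrow> nat \<Rightarrow> complex fps" where
  "crit_laurent d B 0 = B"
| "crit_laurent d B (Suc k) = crit_laurent d B k ^ d + fps_X ^ (d ^ Suc k - 1) * B"

lemma geometric_sum_nat:
  fixes d :: nat
  assumes "d \<ge> 2"
  shows "(d - 1) * (\<Sum>i\<le>k. d ^ i) + 1 = d ^ Suc k"
proof (induction k)
  case 0
  then show ?case using assms by simp
next
  case (Suc k)
  have "(d - 1) * (\<Sum>i\<le>Suc k. d ^ i) + 1 = ((d - 1) * (\<Sum>i\<le>k. d ^ i) + 1) + (d - 1) * d ^ Suc k"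
    by (simp only: sum.atMost_Suc distrib_left add_ac)
  also have "\<dots> = d ^ Suc k + (d - 1) * d ^ Suc k" by (simp only: Suc)
  also have "\<dots> = (1 + (d - 1)) * d ^ Suc k"
    by (simp only: distrib_right mult_1)
  also have "\<dots> = d ^ Suc (Suc k)" using assms by simp
  finally show ?case .
qed

lemma crit_fps_nth_0: "d \<ge> 2 \<Longrightarrow> fps_nth (crit_fps d k) 0 = 1"
proof (induction k)
  case (Suc k)
  define N where "N = (\<Sum>i\<le>k. d ^ i)"
  have "d ^ 0 \<le> N" unfolding N_def by (rule member_le_sum[of 0 "{..k}" "\<lambda>i. d ^ i"]) auto
  then have "N \<noteq> 0" by simp
  moreover have "crit_fps d (Suc k) = crit_fps d k ^ d + fps_X ^ N" by (simp add: N_def)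
  ultimately show ?case using Suc by (simp add: fps_power_zeroth fps_X_power_nth del: crit_fps.simps)
qed simp

lemma crit_fps_compose:
  assumes d: "d \<ge> 2" and B0: "fps_nth B 0 = 1"
  shows "crit_fps d k oo ((fps_X * inverse B) ^ (d - 1)) = crit_laurent d B k * inverse B ^ (d ^ k)"
proof (induction k)
  case 0
  have "B * inverse B = 1" by (rule inverse_mult_eq_1') (simp add: B0)
  then show ?case by simp
next
  case (Suc k)
  let ?z = "(fps_X * inverse B) ^ (d - 1)" and ?N = "\<Sum>i\<le>k. d ^ i"
  have z0: "fps_nth ?z 0 = 0" using d by (simp add: fps_power_zeroth power_0_left)
  have "B * inverse B = 1" by (rule inverse_mult_eq_1') (simp add: B0)
  have e: "(d - 1) * ?N = d ^ Suc k - 1" using geometric_sum_nat[OF d, of k] by simp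
  have pos: "d ^ Suc k = Suc (d ^ Suc k - 1)" using d by simp
  have "?z ^ ?N = (fps_X * inverse B) ^ (d ^ Suc k - 1)"
    by (simp only: power_mult[symmetric] e)
  also have "\<dots> = fps_X ^ (d ^ Suc k - 1) * B * inverse B ^ d ^ Suc k"
  proof -
    have "inverse B ^ (d ^ Suc k - 1) = B * inverse B ^ d ^ Suc k"
      by (subst (2) pos) (simp only: power_Suc mult.assoc[symmetric] \<open>B * inverse B = 1\<close> mult_1)
    then show ?thesis by (simp only: power_mult_distrib mult.assoc)
  qed
  finally have "?z ^ ?N = fps_X ^ (d ^ Suc k - 1) * B * inverse B ^ d ^ Suc k" .
  moreover have "crit_fps d (Suc k) oo ?z = (crit_fps d k oo ?z) ^ d + ?z ^ ?N"
    by (simp only: crit_fps.simps fps_compose_add_distrib fps_compose_power[OF z0, symmetric]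
        fps_X_fps_compose_startby0[OF z0])
  ultimately show ?case
    unfolding Suc by (simp add: power_mult_distrib algebra_simps power_mult[symmetric])
qed

section \<open>Escape of the critical orbit\<close>

lemma coeff_power_leading:
  fixes G :: "complex fps"
  assumes e: "e \<ge> 1" and G: "fps_X ^ e dvd G - 1"
  shows "fps_X ^ e dvd G ^ n - 1 \<and> fps_nth (G ^ n) e = of_nat n * fps_nth G e"
proof (induction n)
  case 0
  then show ?case using e by simp
next
  case (Suc n)
  have *: "G ^ Suc n = 1 + (G - 1) + (G ^ n - 1) + (G - 1) * (G ^ n - 1)"
    by (simp add: algebra_simps)
  have "fps_X ^ Suc e dvd (fps_X ^ (e + e) :: complex fps)"
    using e by (intro le_imp_power_dvd) simp
  moreover have "fps_X ^ (e + e) dvd (G - 1) * (G ^ n - 1)"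
    unfolding power_add using G Suc by (intro mult_dvd_mono) auto
  ultimately have "fps_X ^ Suc e dvd (G - 1) * (G ^ n - 1)" by (rule dvd_trans)
  then have "fps_nth ((G - 1) * (G ^ n - 1)) e = 0" unfolding fps_X_power_dvd_iff by simp
  then have "fps_nth (G ^ Suc n) e = of_nat (Suc n) * fps_nth G e"
    unfolding * using e Suc by (simp add: distrib_right)
  moreover have eq: "G ^ Suc n - 1 = (G - 1) + (G ^ n - 1) + (G - 1) * (G ^ n - 1)"
    by (subst *) simp
  have "fps_X ^ e dvd G ^ Suc n - 1"
    unfolding eq using G Suc by (intro dvd_add dvd_mult2) auto
  ultimately show ?case by blast
qed

text \<open>
  As long as the index stays below the order \<open>d\<^sup>N\<^sup>+\<^sup>1 - 1\<close> of the inhomogeneity in the recursion, the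
  first nonconstant coefficient is just multiplied by \<open>d\<close> in each step; equivalently,
  the corresponding coefficient of the \<open>d\<^sup>n\<close>-th root is stationary.
\<close>
lemma crit_laurent_leading:
  assumes d: "d \<ge> 2" and e: "e \<ge> 1" "e < d ^ Suc N - 1" and G: "fps_X ^ e dvd crit_laurent d B N - 1"
  shows "fps_X ^ e dvd crit_laurent d B (N + k) - 1 \<and>
    fps_nth (crit_laurent d B (N + k)) e = of_nat d ^ k * fps_nth (crit_laurent d B N) e"
proof (induction k)
  case (Suc k)
  let ?G = "crit_laurent d B (N + k)" and ?E = "d ^ Suc (N + k) - 1"
  have "d ^ Suc N \<le> d ^ Suc (N + k)" using d by (intro power_increasing) auto
  then have E: "Suc e \<le> ?E" using e(2) by (simp only: Suc_le_eq less_diff_conv)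
  have *: "crit_laurent d B (N + Suc k) = ?G ^ d + fps_X ^ ?E * B" by simp
  have p: "fps_X ^ e dvd ?G ^ d - 1" "fps_nth (?G ^ d) e = of_nat d * fps_nth ?G e"
    using coeff_power_leading[OF e(1), of ?G d] Suc by auto
  have "fps_X ^ e dvd (?G ^ d - 1) + fps_X ^ ?E * B"
    by (intro dvd_add p(1) dvd_mult2 le_imp_power_dvd) (use E in simp)
  moreover have "fps_nth (fps_X ^ ?E * B) e = 0"
    using E by (simp only: fps_X_power_mult_nth) simp
  ultimately show ?case
    unfolding * using p(2) Suc by (simp add: algebra_simps del: power_Suc) simp
qed (use G in simp)

lemma crit_laurent_nth_0:
  assumes "d \<ge> 2" "fps_nth B 0 = 1"
  shows "fps_nth (crit_laurent d B n) 0 = 1"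
proof (induction n)
  case (Suc n)
  have "1 < d ^ Suc n" using assms(1) by (intro one_less_power) auto
  then show ?case using Suc by (simp add: fps_power_zeroth fps_X_power_mult_nth)
qed (use assms in simp)

lemma fps_expansion_eq:
  fixes f g :: "complex \<Rightarrow> complex"
  assumes "f has_fps_expansion F" "g has_fps_expansion G" "eventually (\<lambda>x. f x = g x) (nhds 0)"
  shows "F = G"
proof (rule fps_expansion_unique_complex[OF assms(1)])
  show "f has_fps_expansion G"
    using has_fps_expansion_cong[OF assms(3) refl] assms(2) by blast
qed

text \<open>
  The Borel-Caratheodory argument for the first nonzero coefficient: if \<open>l\<close> is the logarithm of \<open>h\<close>
  and \<open>Re l \<ge> - T\<close>, then \<open>- l / (2 T + l)\<close> is bounded by \<open>1\<close>, and its leading coefficient is that of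
  \<open>l\<close> divided by \<open>- 2 T\<close>; the Cauchy inequality finishes the proof.
\<close>
lemma log_coeff_bound:
  fixes h :: "complex \<Rightarrow> complex"
  assumes hol: "h holomorphic_on ball 0 1" and nz: "\<And>x. x \<in> ball 0 1 \<Longrightarrow> h x \<noteq> 0"
    and exp: "h has_fps_expansion G" and G0: "fps_nth G 0 = 1"
    and e: "e \<ge> 1" "fps_X ^ e dvd G - 1" and \<rho>: "0 < \<rho>" "\<rho> < 1" and T: "T > 0"
    and low: "\<And>x. cmod x = \<rho> \<Longrightarrow> cmod (h x) \<ge> exp (- T)"
  shows "cmod (fps_nth G e) \<le> 2 * T / \<rho> ^ e"
proof -
  obtain g where g: "g holomorphic_on ball 0 1" "\<And>x. x \<in> ball 0 1 \<Longrightarrow> h x = exp (g x)"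
    using contractible_imp_holomorphic_log[OF hol convex_imp_contractible[OF convex_ball] nz] by metis
  define l where "l = (\<lambda>x. g x - g 0)"
  have h0: "h 0 = 1" using fps_nth_fps_expansion[OF exp, of 0] G0 by simp
  have holl: "l holomorphic_on ball 0 1" unfolding l_def by (intro holomorphic_intros g(1))
  have hl: "h x = exp (l x)" if "x \<in> ball 0 1" for x
    using g(2)[OF that] g(2)[of 0] h0 by (simp add: l_def exp_diff)
  have sub: "cball 0 \<rho> \<subseteq> ball (0 :: complex) 1" "ball 0 \<rho> \<subseteq> ball (0 :: complex) 1"
    using \<rho> by auto
  have contl: "continuous_on (cball 0 \<rho>) l"
    using holl sub(1) holomorphic_on_imp_continuous_on holomorphic_on_subset by blast
  have Re_l: "- T \<le> Re (l x)" if x: "x \<in> cball 0 \<rho>" for x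
  proof -
    have "cmod (exp (- l x)) \<le> exp T"
    proof (rule maximum_modulus_frontier[where S = "cball 0 \<rho>" and f = "\<lambda>x. exp (- l x)"])
      show "(\<lambda>x. exp (- l x)) holomorphic_on interior (cball 0 \<rho>)"
        using holl sub(2) by (auto intro!: holomorphic_intros intro: holomorphic_on_subset)
      show "continuous_on (closure (cball 0 \<rho>)) (\<lambda>x. exp (- l x))"
        using contl by (auto intro!: continuous_intros)
      fix z :: complex assume "z \<in> frontier (cball 0 \<rho>)"
      then have z: "cmod z = \<rho>" by (auto simp: frontier_def)
      then have "exp (- T) \<le> exp (Re (l z))"
        using low[OF z] hl[of z] \<rho> by simp
      then show "cmod (exp (- l z)) \<le> exp T" by simp
    qed (use x in auto)
    then show ?thesis by simp
  qed
  \<comment> \<open>The half plane \<open>Re l \<ge> - T\<close> is mapped into the unit disk, and \<open>0\<close> to \<open>0\<close>.\<close>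
  define \<phi> where "\<phi> = (\<lambda>x. - l x / (of_real (2 * T) + l x))"
  have den: "of_real (2 * T) + l x \<noteq> 0" if "x \<in> cball 0 \<rho>" for x
  proof
    assume "of_real (2 * T) + l x = 0"
    then have "Re (of_real (2 * T) + l x) = 0" by simp
    then show False using Re_l[OF that] T by simp
  qed
  have \<phi>_le: "cmod (\<phi> x) \<le> 1" if "x \<in> cball 0 \<rho>" for x
  proof -
    have "T * (T + Re (l x)) \<ge> 0" using Re_l[OF that] T by simp
    then have "(cmod (l x))\<^sup>2 \<le> (cmod (of_real (2 * T) + l x))\<^sup>2"
      unfolding cmod_power2 by (simp add: power2_eq_square algebra_simps)
    then have "cmod (l x) \<le> cmod (of_real (2 * T) + l x)" by (rule power2_le_imp_le) simp
    then show ?thesis using den[OF that] by (simp add: \<phi>_def norm_divide)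
  qed
  have hol\<phi>: "\<phi> holomorphic_on ball 0 \<rho>"
    unfolding \<phi>_def using den holl sub by (auto intro!: holomorphic_intros intro: holomorphic_on_subset)
  have cont\<phi>: "continuous_on (cball 0 \<rho>) \<phi>"
    unfolding \<phi>_def using den contl by (auto intro!: continuous_intros)
  define F where "F = fps_expansion \<phi> 0"
  define L where "L = fps_expansion l 0"
  have F: "\<phi> has_fps_expansion F" unfolding F_def
    by (rule has_fps_expansion_fps_expansion[OF _ _ hol\<phi>]) (use \<rho> in auto)
  have L: "l has_fps_expansion L" unfolding L_def
    by (rule has_fps_expansion_fps_expansion[OF _ _ holl]) auto
  have bound: "cmod (fps_nth F e) \<le> 1 / \<rho> ^ e"
  proof -
    have "cmod ((deriv ^^ e) \<phi> 0) \<le> fact e * 1 / \<rho> ^ e"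
      by (rule Cauchy_inequality[OF hol\<phi> cont\<phi> \<rho>(1)]) (use \<phi>_le in auto)
    then show ?thesis
      unfolding fps_nth_fps_expansion[OF F] by (simp add: norm_divide field_simps)
  qed
  have ev: "eventually (\<lambda>x. x \<in> ball 0 \<rho>) (nhds (0::complex))"
    using \<rho> by (intro eventually_nhds_in_open) auto
  have L0: "fps_nth L 0 = 0" using L by (simp add: fps_nth_fps_expansion l_def)
  have "(\<lambda>x. \<phi> x * (of_real (2 * T) + l x)) has_fps_expansion F * (fps_const (of_real (2 * T)) + L)"
    by (intro fps_expansion_intros F L)
  moreover have "(\<lambda>x. - l x) has_fps_expansion - L" by (intro fps_expansion_intros L)
  moreover have "eventually (\<lambda>x. \<phi> x * (of_real (2 * T) + l x) = - l x) (nhds 0)"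
    using ev by eventually_elim (use den in \<open>auto simp: \<phi>_def\<close>)
  ultimately have FL: "F * (fps_const (of_real (2 * T)) + L) = - L"
    by (rule fps_expansion_eq)
  have "(\<lambda>x. deriv l x * h x) has_fps_expansion fps_deriv L * G"
    by (intro fps_expansion_intros L exp)
  moreover have "deriv h has_fps_expansion fps_deriv G" by (intro fps_expansion_intros exp)
  moreover have "eventually (\<lambda>x. deriv l x * h x = deriv h x) (nhds 0)"
    using ev
  proof eventually_elim
    case (elim x)
    then have x: "x \<in> ball 0 1" using sub by auto
    have "(l has_field_derivative deriv l x) (at x)"
      using holl x by (simp add: holomorphic_derivI)
    then have "((\<lambda>x. exp (l x)) has_field_derivative exp (l x) * deriv l x) (at x)"
      by (auto intro!: derivative_eq_intros)
    then have "(h has_field_derivative exp (l x) * deriv l x) (at x)"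
      by (rule has_field_derivative_transform_within_open[of _ _ _ "ball 0 1"]) (use x hl in auto)
    then show ?case using hl[OF x] by (simp add: DERIV_imp_deriv mult.commute)
  qed
  ultimately have LG: "fps_deriv L * G = fps_deriv G"
    by (rule fps_expansion_eq)
  obtain e' where e': "e = Suc e'" using e(1) by (cases e) auto
  have inv: "G * inverse G = 1" by (rule inverse_mult_eq_1') (simp add: G0)
  have "fps_deriv L = fps_deriv G * inverse G"
    unfolding LG[symmetric] by (simp add: mult.assoc inv)
  moreover have dG: "fps_X ^ e' dvd fps_deriv G"
    using fps_X_power_dvd_deriv[of e' "G - 1"] e(2) e' by simp
  ultimately have dL: "fps_X ^ e' dvd fps_deriv L" by simp
  have XL: "fps_X ^ e dvd L"
    using fps_X_power_dvd_diff_1[of e' "L + 1"] dL L0 e' by simp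
  have "fps_X ^ (e' + 1) dvd fps_deriv L * (G - 1)"
    unfolding power_add power_one_right using dL e(2) e' by (intro mult_dvd_mono) (auto intro: dvd_trans[OF _ e(2)])
  then have "fps_nth (fps_deriv L * (G - 1)) e' = 0" unfolding fps_X_power_dvd_iff by simp
  moreover have "fps_deriv L * (G - 1) = fps_deriv G - fps_deriv L" using LG by (simp add: right_diff_distrib)
  ultimately have "of_nat e * fps_nth L e = of_nat e * fps_nth G e" by (simp add: e' del: of_nat_Suc)
  then have LGe: "fps_nth L e = fps_nth G e" using e(1) by simp
  \<comment> \<open>So \<open>G\<close> and \<open>L\<close> have the same leading coefficient; now that of \<open>F\<close>.\<close>
  define K where "K = fps_const (of_real (2 * T)) + L"
  have K0: "fps_nth K 0 \<noteq> 0" using T by (simp add: K_def L0)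
  have "F = - L * inverse K"
  proof -
    have "F = F * K * inverse K" by (simp only: mult.assoc inverse_mult_eq_1'[OF K0] mult_1_right)
    also have "F * K = - L" using FL by (simp only: K_def)
    finally show ?thesis .
  qed
  then have XF: "fps_X ^ e dvd F" using XL by simp
  have "fps_X ^ (e + 1) dvd F * L"
    unfolding power_add power_one_right
    by (intro mult_dvd_mono XF dvd_trans[OF _ XL]) (simp add: e')
  then have "fps_nth (F * L) e = 0" unfolding fps_X_power_dvd_iff by simp
  then have "fps_nth (F * K) e = of_real (2 * T) * fps_nth F e"
    by (simp add: K_def distrib_left)
  then have "- fps_nth G e = of_real (2 * T) * fps_nth F e"
    using FL LGe by (simp add: K_def)
  then have "cmod (fps_nth G e) = 2 * T * cmod (fps_nth F e)"
  proof -
    assume "- fps_nth G e = of_real (2 * T) * fps_nth F e"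
    then have "cmod (- fps_nth G e) = cmod (of_real (2 * T) * fps_nth F e)" by (rule arg_cong)
    then show ?thesis using T by (simp only: norm_mult norm_of_real norm_minus_cancel abs_of_pos mult_pos_pos zero_less_numeral)
  qed
  also have "\<dots> \<le> 2 * T * (1 / \<rho> ^ e)" using bound T by (intro mult_left_mono) auto
  finally show ?thesis by simp
qed

lemma crit_laurent_conv_radius:
  "fps_conv_radius B \<ge> 1 \<Longrightarrow> fps_conv_radius (crit_laurent d B n) \<ge> 1"
proof (induction n)
  case (Suc n)
  have "1 \<le> fps_conv_radius (crit_laurent d B n ^ d)"
    by (rule order_trans[OF Suc.IH[OF Suc.prems] fps_conv_radius_power])
  then show ?case
    unfolding crit_laurent.simps
    by (intro fps_conv_radius_add_ge fps_conv_radius_mult_ge) (use Suc in simp_all)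
qed simp

lemma eval_crit_laurent:
  assumes d: "d \<ge> 2" and B: "fps_conv_radius B \<ge> 1" and x: "cmod x < 1" "x \<noteq> 0"
    and c: "eval_fps B x = x * c"
  shows "eval_fps (crit_laurent d B n) x = x ^ (d ^ n) * (unicrit d c ^^ n) c"
proof (induction n)
  case (Suc n)
  have x1: "ereal (cmod x) < 1" using x by (simp add: one_ereal_def)
  have xr: "ereal (cmod x) < fps_conv_radius (crit_laurent d B k)" "ereal (cmod x) < fps_conv_radius B" for k
    using less_le_trans[OF x1 crit_laurent_conv_radius[OF B]] less_le_trans[OF x1 B] .
  have xp: "ereal (cmod x) < fps_conv_radius (crit_laurent d B n ^ d)"
    by (rule less_le_trans[OF xr(1) fps_conv_radius_power])
  have "1 \<le> fps_conv_radius (fps_X ^ (d ^ Suc n - 1) * B)"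
    by (intro fps_conv_radius_mult_ge B) simp
  then have xm: "ereal (cmod x) < fps_conv_radius (fps_X ^ (d ^ Suc n - 1) * B)"
    by (rule less_le_trans[OF x1])
  have pos: "d ^ Suc n - 1 + 1 = d ^ Suc n" using d by simp
  have "eval_fps (crit_laurent d B (Suc n)) x =
      eval_fps (crit_laurent d B n) x ^ d + x ^ (d ^ Suc n - 1) * eval_fps B x"
    unfolding crit_laurent.simps eval_fps_add[OF xp xm] eval_fps_power[OF xr(1)]
    by (subst eval_fps_mult) (simp_all add: xr(2) del: power_Suc)
  also have "x ^ (d ^ Suc n - 1) * eval_fps B x = x ^ (d ^ Suc n) * c"
    unfolding c by (subst (2) pos[symmetric]) (simp only: power_add power_one_right mult.assoc)
  finally show ?case
  proof -
    assume "eval_fps (crit_laurent d B (Suc n)) x = eval_fps (crit_laurent d B n) x ^ d + x ^ d ^ Suc n * c"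
    also have "eval_fps (crit_laurent d B n) x ^ d = x ^ d ^ Suc n * (unicrit d c ^^ n) c ^ d"
      unfolding Suc power_mult_distrib power_mult[symmetric] power_Suc2 ..
    also have "\<dots> + x ^ d ^ Suc n * c = x ^ d ^ Suc n * unicrit d c ((unicrit d c ^^ n) c)"
      by (simp only: unicrit_def distrib_left)
    finally show ?thesis by simp
  qed
qed (simp add: c)

text \<open>An orbit of the critical value that hits \<open>0\<close> is periodic, hence cannot escape.\<close>
lemma escape_imp_orbit_nonzero:
  assumes d: "d \<ge> 2" and esc: "cmod ((unicrit d c ^^ k) c) > cmod c + 3"
  shows "(unicrit d c ^^ n) c \<noteq> 0"
proof
  assume "(unicrit d c ^^ n) c = 0"
  then have per: "(unicrit d c ^^ Suc n) c = c" using d by (simp add: unicrit_def)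
  have "((unicrit d c ^^ Suc n) ^^ j) c = c" for j
    by (induction j) (use per in simp_all)
  then have "(unicrit d c ^^ (Suc n * k)) c = c" by (simp only: funpow_mult)
  moreover have "2 ^ (n * k) * cmod ((unicrit d c ^^ k) c) \<le> cmod ((unicrit d c ^^ (k + n * k)) c)"
    by (rule unicrit_escape[OF d]) (use esc in simp)
  moreover have "1 * cmod ((unicrit d c ^^ k) c) \<le> 2 ^ (n * k) * cmod ((unicrit d c ^^ k) c)"
    by (intro mult_right_mono) auto
  ultimately show False using esc by simp
qed

lemma continuous_on_critical_orbit: "continuous_on S (\<lambda>c. (unicrit d c ^^ n) c)"
  by (induction n) (auto simp: unicrit_def intro!: continuous_intros)

lemma uniform_escape:
  fixes C :: "complex set"
  assumes d: "d \<ge> 2" and C: "compact C" and esc: "\<And>c. c \<in> C \<Longrightarrow> \<exists>n. cmod ((unicrit d c ^^ n) c) > cmod c + 3"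
  shows "\<exists>n0. \<forall>n\<ge>n0. \<forall>c\<in>C. cmod ((unicrit d c ^^ n) c) \<ge> 1"
proof -
  let ?O = "\<lambda>n. {c. cmod ((unicrit d c ^^ n) c) > cmod c + 3}"
  have op: "open (?O n)" for n
    by (intro open_Collect_less continuous_intros continuous_on_critical_orbit)
  have cover: "C \<subseteq> (\<Union>n. ?O n)" using esc by blast
  obtain I where I: "finite I" "C \<subseteq> (\<Union>n\<in>I. ?O n)"
    by (rule compactE_image[OF C op cover])
  show ?thesis
  proof (intro exI allI impI ballI)
    fix n c assume n: "Max (insert 0 I) \<le> n" and c: "c \<in> C"
    obtain k where k: "k \<in> I" "cmod ((unicrit d c ^^ k) c) > cmod c + 3" using I(2) c by blast
    have "k \<le> n" using k(1) n I(1) by (meson Max_ge finite_insert insertCI order_trans)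
    then have "2 ^ (n - k) * cmod ((unicrit d c ^^ k) c) \<le> cmod ((unicrit d c ^^ n) c)"
      using unicrit_escape[OF d, of c k c "n - k"] k(2) by simp
    moreover have "1 * cmod ((unicrit d c ^^ k) c) \<le> 2 ^ (n - k) * cmod ((unicrit d c ^^ k) c)"
      by (intro mult_right_mono) auto
    ultimately show "1 \<le> cmod ((unicrit d c ^^ n) c)" using k(2) norm_ge_zero[of c] by linarith
  qed
qed

text \<open>
  The bound \<open>\<bar>Q\<^sub>n\<bar> \<ge> 1\<close> for large \<open>n\<close>, uniform on circles, drives the proof. In potential-theoretic terms, the
  Green function of the parameter plane is nonnegative and has the same logarithmic pole as
  \<open>log \<bar>w\<bar>\<close>, so that the maximum principle forces both to agree.
\<close>
theorem crit_laurent_near_1: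
  assumes d: "d \<ge> 2" and B0: "fps_nth B 0 = 1" and B: "fps_conv_radius B \<ge> 1"
    and esc: "\<And>x. 0 < cmod x \<Longrightarrow> cmod x < 1 \<Longrightarrow> \<exists>n. cmod ((unicrit d (eval_fps B x / x) ^^ n) (eval_fps B x / x)) > cmod (eval_fps B x / x) + 3"
  shows "fps_X ^ (d ^ Suc N - 1) dvd crit_laurent d B N - 1"
proof -
  let ?G = "crit_laurent d B"
  let ?c = "\<lambda>x. eval_fps B x / x"
  have lt: "ereal (cmod x) < fps_conv_radius (?G n)" if "cmod x < 1" for x n
    by (rule less_le_trans[OF _ crit_laurent_conv_radius[OF B]]) (use that in \<open>simp add: one_ereal_def\<close>)
  then have "ball (0 :: complex) 1 \<subseteq> eball 0 (fps_conv_radius (?G n))" for n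
    unfolding subset_iff in_eball_iff mem_ball dist_0_norm by blast
  then have hol: "eval_fps (?G n) holomorphic_on ball 0 1" for n
    by (rule holomorphic_on_eval_fps)
  have "0 < fps_conv_radius (?G n)" for n
    by (rule less_le_trans[OF _ crit_laurent_conv_radius[OF B]]) simp
  then have exp: "eval_fps (?G n) has_fps_expansion ?G n" for n
    by (rule eval_fps_has_fps_expansion)
  have ev: "eval_fps (?G n) x = x ^ (d ^ n) * (unicrit d (?c x) ^^ n) (?c x)" if "0 < cmod x" "cmod x < 1" for n x
    by (rule eval_crit_laurent[OF d B]) (use that in auto)
  have nz: "eval_fps (?G n) x \<noteq> 0" if "x \<in> ball 0 1" for n x
  proof (cases "x = 0")
    case True
    then show ?thesis by (simp add: eval_fps_at_0 crit_laurent_nth_0[OF d B0])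
  next
    case False
    then have x: "0 < cmod x" "cmod x < 1" using that by auto
    obtain k where "cmod ((unicrit d (?c x) ^^ k) (?c x)) > cmod (?c x) + 3" using esc[OF x] by blast
    then show ?thesis
      unfolding ev[OF x] using escape_imp_orbit_nonzero[OF d] False by auto
  qed
  have step: "fps_nth (?G N) e = 0"
    if e: "e \<ge> 1" "e < d ^ Suc N - 1" and dvd: "fps_X ^ e dvd ?G N - 1" for e
  proof -
    define g where "g = cmod (fps_nth (?G N) e)"
    have bound: "g \<le> 2 * real d ^ N * ln (1 / \<rho>) / \<rho> ^ e" if \<rho>: "0 < \<rho>" "\<rho> < 1" for \<rho>
    proof -
      have "compact (?c ` sphere 0 \<rho>)"
      proof (rule compact_continuous_image)
        have "continuous_on (sphere 0 \<rho>) (eval_fps B)"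
          using hol[of 0] \<rho> by (auto intro!: holomorphic_on_imp_continuous_on intro: holomorphic_on_subset)
        then show "continuous_on (sphere 0 \<rho>) ?c"
          using \<rho> by (intro continuous_on_divide continuous_on_id) auto
      qed simp
      then obtain n0 where n0: "\<And>n c. n \<ge> n0 \<Longrightarrow> c \<in> ?c ` sphere 0 \<rho> \<Longrightarrow> cmod ((unicrit d c ^^ n) c) \<ge> 1"
        using uniform_escape[OF d, of "?c ` sphere 0 \<rho>"] esc \<rho> by fastforce
      define T where "T = real d ^ (N + n0) * ln (1 / \<rho>)"
      have T: "T > 0" unfolding T_def using d \<rho> by (intro mult_pos_pos) auto
      have eT: "exp (- T) = \<rho> ^ (d ^ (N + n0))"
      proof -
        have "exp (- T) = exp (real (d ^ (N + n0)) * ln \<rho>)" using \<rho> by (simp add: T_def ln_div)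
        also have "\<dots> = \<rho> ^ (d ^ (N + n0))" unfolding exp_of_nat_mult using \<rho> by simp
        finally show ?thesis .
      qed
      have lead: "fps_X ^ e dvd ?G (N + n0) - 1" "fps_nth (?G (N + n0)) e = of_nat d ^ n0 * fps_nth (?G N) e"
        using crit_laurent_leading[OF d e dvd] by blast+
      have "cmod (fps_nth (?G (N + n0)) e) \<le> 2 * T / \<rho> ^ e"
      proof (rule log_coeff_bound[OF hol nz exp crit_laurent_nth_0[OF d B0] e(1) lead(1) \<rho> T])
        fix x :: complex assume x: "cmod x = \<rho>"
        have "1 \<le> cmod ((unicrit d (?c x) ^^ (N + n0)) (?c x))" by (rule n0) (use x in auto)
        then have "\<rho> ^ (d ^ (N + n0)) * 1 \<le> \<rho> ^ (d ^ (N + n0)) * cmod ((unicrit d (?c x) ^^ (N + n0)) (?c x))"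
          using \<rho> by (intro mult_left_mono) auto
        then show "exp (- T) \<le> cmod (eval_fps (?G (N + n0)) x)"
          unfolding eT using x \<rho> by (subst ev) (auto simp: norm_mult norm_power)
      qed
      then have "real d ^ n0 * g \<le> real d ^ n0 * (2 * real d ^ N * ln (1 / \<rho>) / \<rho> ^ e)"
        unfolding lead(2) by (simp add: norm_mult norm_power g_def T_def power_add mult_ac)
      then show ?thesis using d by (subst (asm) mult_le_cancel_left_pos) auto
    qed
    have "((\<lambda>\<rho>. 2 * real d ^ N * ln (1 / \<rho>) / \<rho> ^ e) \<longlongrightarrow> 2 * real d ^ N * ln (1 / 1) / 1 ^ e) (at_left 1)"
      by (intro tendsto_intros) auto
    then have "((\<lambda>\<rho>. 2 * real d ^ N * ln (1 / \<rho>) / \<rho> ^ e) \<longlongrightarrow> 0) (at_left 1)" by simp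
    moreover have "eventually (\<lambda>\<rho>::real. \<rho> \<in> {0<..<1}) (at_left 1)"
      by (intro eventually_at_leftI[of 0]) auto
    then have "eventually (\<lambda>\<rho>. g \<le> 2 * real d ^ N * ln (1 / \<rho>) / \<rho> ^ e) (at_left 1)"
      by eventually_elim (use bound in auto)
    ultimately have "g \<le> 0" by (rule tendsto_lowerbound) simp
    then show ?thesis by (simp add: g_def)
  qed
  have "fps_nth (?G N - 1) e = 0" if "e < d ^ Suc N - 1" for e
    using that
  proof (induction e rule: less_induct)
    case (less e)
    show ?case
    proof (cases "e = 0")
      case True
      then show ?thesis using crit_laurent_nth_0[OF d B0] by simp
    next
      case False
      have "fps_X ^ e dvd ?G N - 1" unfolding fps_X_power_dvd_iff using less by auto
      then show ?thesis using step[of e] False less.prems by simp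
    qed
  qed
  then show ?thesis unfolding fps_X_power_dvd_iff by blast
qed

section \<open>Lagrange inversion\<close>

text \<open>The logarithmic derivative of the \<open>d\<^sup>k\<close>-th root of \<^term>\<open>crit_fps d k\<close>.\<close>
definition log_deriv :: "nat \<Rightarrow> nat \<Rightarrow> complex fps" where
  "log_deriv d k = fps_const (1 / of_nat d ^ k) * (fps_deriv (crit_fps d k) * inverse (crit_fps d k))"

text \<open>
  As \<^term>\<open>crit_fps d k\<close> at \<open>z\<close> is \<^term>\<open>crit_laurent d B k\<close> divided by \<open>B ^ d\<^sup>k\<close>, its logarithmic derivative
  is a difference, and the \<open>d\<^sup>k\<close>-th root turns the contribution of \<open>B ^ d\<^sup>k\<close> into \<open>B' / B\<close>.
\<close>
lemma log_deriv_compose: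
  assumes d: "d \<ge> 2" and B0: "fps_nth B 0 = 1" and G0: "fps_nth (crit_laurent d B k) 0 = 1"
  defines "z \<equiv> (fps_X * inverse B) ^ (d - 1)"
  shows "(log_deriv d k oo z) * fps_deriv z =
    fps_const (1 / of_nat d ^ k) * (fps_deriv (crit_laurent d B k) * inverse (crit_laurent d B k)) - fps_deriv B * inverse B"
proof -
  let ?q = "crit_fps d k" and ?G = "crit_laurent d B k" and ?D = "d ^ k"
  have z0: "fps_nth z 0 = 0" using d by (simp add: z_def fps_power_zeroth power_0_left)
  have q0: "fps_nth ?q 0 = 1" by (rule crit_fps_nth_0[OF d])
  have invB: "B * inverse B = 1" by (rule inverse_mult_eq_1') (simp add: B0)
  have invG: "?G * inverse ?G = 1" by (rule inverse_mult_eq_1') (simp add: G0)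
  obtain e where e: "?D = Suc e" using d by (cases ?D) auto
  have qz: "?q oo z = ?G * inverse B ^ ?D" unfolding z_def by (rule crit_fps_compose[OF d B0])
  have "inverse ?q oo z = inverse (?q oo z)"
    by (rule fps_inverse_compose[OF z0]) (simp add: q0)
  also have "\<dots> = inverse ?G * B ^ ?D"
    unfolding qz fps_inverse_mult fps_inverse_power
    by (simp add: fps_inverse_idempotent B0)
  finally have iq: "inverse ?q oo z = inverse ?G * B ^ ?D" .
  have dq: "fps_deriv (?q oo z) = fps_deriv ?G * inverse B ^ ?D - ?G * of_nat ?D * fps_deriv B * inverse B ^ (?D + 1)"
    unfolding qz e fps_deriv_mult fps_deriv_power'
    by (simp add: fps_inverse_deriv B0 power2_eq_square algebra_simps)
  then have "fps_deriv (?q oo z) * (inverse ?q oo z) =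
      fps_deriv ?G * inverse ?G * (B * inverse B) ^ ?D
      - of_nat ?D * fps_deriv B * inverse B * (?G * inverse ?G) * (B * inverse B) ^ ?D"
    unfolding iq dq by (simp add: algebra_simps power_mult_distrib)
  also have "\<dots> = fps_deriv ?G * inverse ?G - of_nat ?D * (fps_deriv B * inverse B)"
    by (simp add: invB invG mult.assoc)
  finally have *: "fps_deriv (?q oo z) * (inverse ?q oo z) =
      fps_deriv ?G * inverse ?G - of_nat ?D * (fps_deriv B * inverse B)" .
  have "(log_deriv d k oo z) * fps_deriv z = fps_const (1 / of_nat ?D) * (fps_deriv (?q oo z) * (inverse ?q oo z))"
    by (simp add: log_deriv_def fps_compose_mult_distrib[OF z0] fps_compose_deriv[OF z0] mult_ac)
  moreover have "fps_const (1 / of_nat ?D) * of_nat ?D = (1 :: complex fps)"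
    unfolding fps_of_nat[symmetric, of "d ^ k", where ?'a = complex] fps_const_mult using d by simp
  ultimately show ?thesis
    unfolding * by (simp add: right_diff_distrib mult.assoc[symmetric])
qed

text \<open>
  The formal residue computation behind Lagrange inversion. With \<open>C = B / x\<close> the left-hand side is
  the residue of \<open>C ^ (m + 1)\<close> times the derivative of \<open>C powr (-i)\<close>, which is a derivative itself
  unless \<open>i = m + 1\<close>.
\<close>
lemma coeff_deriv_power_pairing:
  fixes B :: "complex fps"
  assumes B0: "fps_nth B 0 = 1" and "i \<ge> 1"
  shows "fps_nth (B ^ (m + 1) * fps_deriv ((fps_X * inverse B) ^ i)) m =
    (if i = m + 1 then of_nat (m + 1) else 0)"
proof -
  have inv: "B * inverse B = 1" by (rule inverse_mult_eq_1') (simp add: B0)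
  obtain j where i: "i = Suc j" using \<open>i \<ge> 1\<close> by (cases i) auto
  have deriv: "fps_deriv (fps_X * inverse B) = inverse B - fps_X * fps_deriv B * inverse B ^ 2"
    by (simp add: fps_inverse_deriv B0 power2_eq_square algebra_simps)
  have eq: "fps_deriv ((fps_X * inverse B) ^ i) =
      of_nat i * fps_X ^ j * (inverse B ^ i - fps_X * fps_deriv B * inverse B ^ (i + 1))"
    unfolding fps_deriv_power' deriv i
    by (simp add: algebra_simps power_mult_distrib power2_eq_square)
  show ?thesis
  proof (cases "i \<le> m")
    case True
    define k where "k = m + 1 - i"
    have k: "m + 1 = k + i" "k \<ge> 1" using True by (auto simp: k_def)
    then obtain k' where k': "k = Suc k'" by (cases k) auto
    have "B ^ (m + 1) * (inverse B ^ i - fps_X * fps_deriv B * inverse B ^ (i + 1)) =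
        B ^ k * (B * inverse B) ^ i - fps_X * fps_deriv B * B ^ k' * (B * inverse B) ^ (i + 1)"
      unfolding k(1) by (simp add: k' power_add power_mult_distrib algebra_simps)
    also have "\<dots> = B ^ k - fps_X * (fps_deriv B * B ^ k')" by (simp add: inv algebra_simps)
    finally have *: "B ^ (m + 1) * fps_deriv ((fps_X * inverse B) ^ i) =
        fps_X ^ j * (of_nat i * (B ^ k - fps_X * (fps_deriv B * B ^ k')))"
      unfolding eq by (simp only: mult_ac)
    have mj: "m = j + k" using k i by simp
    have "fps_nth (fps_deriv (B ^ k)) k' = of_nat k * fps_nth (fps_deriv B * B ^ k') k'"
      unfolding fps_deriv_power' by (simp add: k' mult.assoc fps_mult_of_nat_nth del: of_nat_Suc)
    then have "of_nat k * fps_nth (B ^ k) k = of_nat k * fps_nth (fps_deriv B * B ^ k') k'"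
      by (simp only: fps_deriv_nth k' Suc_eq_plus1)
    then have Bk: "fps_nth (B ^ k) k = fps_nth (fps_deriv B * B ^ k') k'"
      using k(2) by simp
    show ?thesis
    proof -
      have "fps_nth (B ^ k - fps_X * (fps_deriv B * B ^ k')) k = 0"
        using Bk k' by simp
      then have "fps_nth (B ^ (m + 1) * fps_deriv ((fps_X * inverse B) ^ i)) m = 0"
        unfolding * by (simp only: fps_X_power_mult_nth mj fps_mult_of_nat_nth) simp
      then show ?thesis using True by simp
    qed
  next
    case False
    have "B ^ (m + 1) * fps_deriv ((fps_X * inverse B) ^ i) =
        fps_X ^ j * (of_nat i * (B ^ (m + 1) * (inverse B ^ i - fps_X * fps_deriv B * inverse B ^ (i + 1))))"
      unfolding eq by (simp only: mult_ac)
    moreover define R where "R = B ^ (m + 1) * (inverse B ^ i - fps_X * fps_deriv B * inverse B ^ (i + 1))"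
    ultimately have "fps_nth (B ^ (m + 1) * fps_deriv ((fps_X * inverse B) ^ i)) m =
        (if m < j then 0 else of_nat i * fps_nth R (m - j))"
      by (simp only: fps_X_power_mult_nth fps_mult_of_nat_nth)
    moreover have "fps_nth R 0 = 1"
      by (simp add: R_def fps_power_zeroth B0)
    ultimately show ?thesis
      using False i by (cases "m < j") auto
  qed
qed

lemma fps_of_nat_compose: "of_nat n oo f = (of_nat n :: complex fps)"
  by (simp only: fps_of_nat[symmetric] fps_const_compose)

text \<open>
  If \<open>w\<close> denotes \<open>y\<close> evaluated at \<open>z = (x / B) ^ (d - 1)\<close>, the differential equation integrates to
  \<open>(1 + m w) B ^ m = 1\<close> up to terms of high order. Then \<open>B ^ (m + 1) w'\<close> is \<open>- B'\<close> up to such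
  terms, and its coefficient at \<open>x ^ m\<close> can also be computed term by term from the powers of \<open>z\<close>. Using
  \<open>B ^ (m + 1) w'\<close> instead of \<open>B ^ m\<close> avoids dividing by \<open>m\<close>.
\<close>
lemma lagrange_coeff:
  fixes y B :: "complex fps"
  assumes d: "d \<ge> 2" and B0: "fps_nth B 0 = 1" and am: "(d - 1) * a = m + 1"
    and G: "fps_X ^ (m + 2) dvd crit_laurent d B k - 1"
    and y: "fps_deriv y = log_deriv d k * (1 + of_nat m * y)" "fps_nth y 0 = 0"
  shows "fps_nth B (m + 1) = - fps_nth y a"
proof -
  let ?G = "crit_laurent d B k"
  define z where "z = (fps_X * inverse B) ^ (d - 1)"
  define w where "w = y oo z"
  define \<epsilon> where "\<epsilon> = fps_const (1 / of_nat d ^ k) * (fps_deriv ?G * inverse ?G)"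
  have z0: "fps_nth z 0 = 0" using d by (simp add: z_def fps_power_zeroth power_0_left)
  have invB: "B * inverse B = 1" by (rule inverse_mult_eq_1') (simp add: B0)
  have "fps_nth (?G - 1) 0 = 0" 
    using G unfolding fps_X_power_dvd_iff by (metis add_2_eq_Suc' zero_less_Suc)
  then have G0: "fps_nth ?G 0 = 1" by simp
  have "fps_X ^ (m + 1) dvd fps_deriv (?G - 1)"
    using G by (intro fps_X_power_dvd_deriv) simp
  then have \<epsilon>: "fps_X ^ (m + 1) dvd \<epsilon>"
    by (simp add: \<epsilon>_def)
  have "fps_deriv w = (fps_deriv y oo z) * fps_deriv z"
    unfolding w_def by (rule fps_compose_deriv[OF z0])
  also have "\<dots> = ((log_deriv d k oo z) * fps_deriv z) * (1 + of_nat m * w)"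
    unfolding y(1) fps_compose_mult_distrib[OF z0] w_def
    by (simp add: fps_compose_add_distrib fps_compose_mult_distrib[OF z0] fps_of_nat_compose mult_ac)
  also have "(log_deriv d k oo z) * fps_deriv z = \<epsilon> - fps_deriv B * inverse B"
    unfolding z_def \<epsilon>_def by (rule log_deriv_compose[OF d B0 G0])
  finally have w': "fps_deriv w = (\<epsilon> - fps_deriv B * inverse B) * (1 + of_nat m * w)" .
  define P where "P = (1 + of_nat m * w) * B ^ m"
  have dB: "fps_deriv (B ^ m) = of_nat m * fps_deriv B * inverse B * B ^ m"
  proof (cases m)
    case (Suc m')
    have "inverse B * B ^ m = B ^ m' * (B * inverse B)" by (simp add: Suc)
    then show ?thesis unfolding fps_deriv_power' mult.assoc by (simp add: invB Suc mult_ac)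
  qed simp
  have "fps_deriv P = \<epsilon> * (of_nat m * P)"
    unfolding P_def fps_deriv_mult dB by (simp add: w' algebra_simps)
  then have "fps_X ^ (m + 1) dvd fps_deriv P" using \<epsilon> by simp
  moreover have "fps_nth P 0 = 1"
    by (simp add: P_def w_def y(2) fps_power_zeroth B0 fps_mult_of_nat_nth)
  ultimately have "fps_X ^ Suc (m + 1) dvd P - 1" by (rule fps_X_power_dvd_diff_1)
  then have P1: "fps_X ^ (m + 1) dvd P - 1" by (rule power_le_dvd) simp
  have "B ^ (m + 1) * fps_deriv w = B * \<epsilon> * P - fps_deriv B * P * (B * inverse B)"
    unfolding w' P_def by (simp add: algebra_simps)
  then have "B ^ (m + 1) * fps_deriv w + fps_deriv B = \<epsilon> * (B * P) - fps_deriv B * (P - 1)"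
    by (simp add: invB algebra_simps)
  then have "fps_X ^ (m + 1) dvd B ^ (m + 1) * fps_deriv w + fps_deriv B"
    using \<epsilon> P1 by simp
  then have "fps_nth (B ^ (m + 1) * fps_deriv w + fps_deriv B) m = 0"
    unfolding fps_X_power_dvd_iff by simp
  then have lhs: "fps_nth (B ^ (m + 1) * fps_deriv w) m = - (of_nat (m + 1) * fps_nth B (m + 1))"
    by (simp add: add_eq_0_iff)
  define S where "S = (\<Sum>j\<le>m+1. fps_const (fps_nth y j) * z ^ j)"
  have "fps_X ^ Suc (m + 1) dvd w - S"
    unfolding fps_X_power_dvd_iff
  proof (intro allI impI)
    fix i assume i: "i < Suc (m + 1)"
    have "fps_nth (z ^ j) i = 0" if "j > i" for j
      using startsby_zero_power_prefix[of z j] z0 that by auto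
    then have "fps_nth S i = (\<Sum>j\<in>{0..i}. fps_nth y j * fps_nth (z ^ j) i)"
      unfolding S_def fps_sum_nth using i by (intro sum.mono_neutral_cong_right) auto
    then show "fps_nth (w - S) i = 0" by (simp add: w_def fps_compose_nth)
  qed
  then have "fps_X ^ (m + 1) dvd B ^ (m + 1) * fps_deriv (w - S)"
    by (intro dvd_mult fps_X_power_dvd_deriv)
  then have "fps_nth (B ^ (m + 1) * fps_deriv (w - S)) m = 0"
    unfolding fps_X_power_dvd_iff by simp
  then have "fps_nth (B ^ (m + 1) * fps_deriv w) m = fps_nth (B ^ (m + 1) * fps_deriv S) m"
    by (simp add: right_diff_distrib)
  also have "B ^ (m + 1) * fps_deriv S =
      (\<Sum>j\<le>m+1. fps_const (fps_nth y j) * (B ^ (m + 1) * fps_deriv (z ^ j)))"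
    unfolding S_def fps_deriv_sum by (simp add: sum_distrib_left mult_ac del: sum.atMost_Suc power_Suc)
  also have "fps_nth \<dots> m = (\<Sum>j\<le>m+1. if j = a then fps_nth y a * of_nat (m + 1) else 0)"
    unfolding fps_sum_nth
  proof (intro sum.cong refl)
    fix j
    show "fps_nth (fps_const (fps_nth y j) * (B ^ (m + 1) * fps_deriv (z ^ j))) m =
        (if j = a then fps_nth y a * of_nat (m + 1) else 0)"
    proof (cases "j = 0")
      case True
      then show ?thesis using am by auto
    next
      case False
      have "z ^ j = (fps_X * inverse B) ^ ((d - 1) * j)" by (simp add: z_def power_mult)
      moreover have "(d - 1) * j = m + 1 \<longleftrightarrow> j = a" using d am[symmetric] by simp
      moreover have "(d - 1) * j \<ge> 1" using d False by simp
      ultimately show ?thesis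
        using coeff_deriv_power_pairing[OF B0, of "(d - 1) * j" m] by simp
    qed
  qed
  also have "\<dots> = fps_nth y a * of_nat (m + 1)"
  proof -
    have "1 * a \<le> (d - 1) * a" using d by (intro mult_le_mono1) auto
    then have "a \<le> m + 1" unfolding am by simp
    then show ?thesis by (simp del: sum.atMost_Suc)
  qed
  finally have "of_nat (m + 1) * fps_nth B (m + 1) = of_nat (m + 1) * (- fps_nth y a)"
    using lhs by (simp add: algebra_simps del: of_nat_add of_nat_Suc)
  moreover have "of_nat (m + 1) \<noteq> (0 :: complex)" by (simp only: of_nat_eq_0_iff)
  ultimately show ?thesis using mult_left_cancel by blast
qed

section \<open>Denominators of the coefficients\<close>

text \<open>The localization of the integers at p, inside the complex numbers.\<close>
definition padic_ints :: "nat \<Rightarrow> complex set" where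
  "padic_ints p = {of_int r / of_int s |r s. \<not> int p dvd s}"

definition padic_ideal :: "nat \<Rightarrow> complex set" where
  "padic_ideal p = (\<lambda>x. of_nat p * x) ` padic_ints p"

lemma padic_intsE:
  assumes "x \<in> padic_ints p"
  obtains r s where "x = of_int r / of_int s" "\<not> int p dvd s" "s \<noteq> 0"
  using assms unfolding padic_ints_def by force

definition integral_fps :: "nat \<Rightarrow> complex fps \<Rightarrow> bool" where
  "integral_fps p f \<longleftrightarrow> (\<forall>n. fps_nth f n \<in> padic_ints p)"

context
  fixes p :: nat
  assumes p: "prime p"
begin

lemma of_int_padic_ints: "of_int r \<in> padic_ints p"
proof -
  have "\<not> int p dvd 1" using prime_gt_1_nat[OF p] by (simp add: zdvd1_eq)
  moreover have "(of_int r :: complex) = of_int r / of_int 1" by simp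
  ultimately show ?thesis unfolding padic_ints_def by blast
qed

lemma of_nat_padic_ints: "of_nat n \<in> padic_ints p"
  using of_int_padic_ints[of "int n"] by simp

lemma padic_ints_0: "0 \<in> padic_ints p" and padic_ints_1: "1 \<in> padic_ints p"
  using of_nat_padic_ints[of 0] of_nat_padic_ints[of 1] by simp_all

lemma padic_ints_add: 
  assumes "x \<in> padic_ints p" "y \<in> padic_ints p" shows "x + y \<in> padic_ints p"
proof -
  from assms obtain r s r' s' where *: "x = of_int r / of_int s" "\<not> int p dvd s" "s \<noteq> 0"
    "y = of_int r' / of_int s'" "\<not> int p dvd s'" "s' \<noteq> 0"
    by (metis padic_intsE)
  then have "x + y = of_int (r * s' + r' * s) / of_int (s * s')"
    by (simp add: field_simps)
  moreover have "\<not> int p dvd s * s'" using * p by (simp add: prime_dvd_mult_iff)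
  ultimately show ?thesis unfolding padic_ints_def by blast
qed

lemma padic_ints_mult: 
  assumes "x \<in> padic_ints p" "y \<in> padic_ints p" shows "x * y \<in> padic_ints p"
proof -
  from assms obtain r s r' s' where *: "x = of_int r / of_int s" "\<not> int p dvd s" "s \<noteq> 0"
    "y = of_int r' / of_int s'" "\<not> int p dvd s'" "s' \<noteq> 0"
    by (metis padic_intsE)
  then have "x * y = of_int (r * r') / of_int (s * s')" by simp
  moreover have "\<not> int p dvd s * s'" using * p by (simp add: prime_dvd_mult_iff)
  ultimately show ?thesis unfolding padic_ints_def by blast
qed

lemma padic_ints_uminus: "x \<in> padic_ints p \<Longrightarrow> - x \<in> padic_ints p"
  using padic_ints_mult[OF of_int_padic_ints[of "-1"]] by simp

lemma padic_ints_diff: "x \<in> padic_ints p \<Longrightarrow> y \<in> padic_ints p \<Longrightarrow> x - y \<in> padic_ints p"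
  using padic_ints_add[of x "- y"] padic_ints_uminus by simp

lemma padic_ints_power: "x \<in> padic_ints p \<Longrightarrow> x ^ n \<in> padic_ints p"
  by (induction n) (auto intro: padic_ints_1 padic_ints_mult)

lemma padic_ints_sum: "(\<And>i. i \<in> I \<Longrightarrow> f i \<in> padic_ints p) \<Longrightarrow> sum f I \<in> padic_ints p"
  by (induction I rule: infinite_finite_induct) (auto intro: padic_ints_0 padic_ints_add)

lemma padic_ints_inverse_of_nat: "\<not> p dvd n \<Longrightarrow> 1 / of_nat n \<in> padic_ints p"
proof -
  assume "\<not> p dvd n"
  then have "\<not> int p dvd int n" by simp
  moreover have "1 / of_nat n = (of_int 1 / of_int (int n) :: complex)" by simp
  ultimately show ?thesis unfolding padic_ints_def by blast
qed

lemma padic_ideal_subset: "x \<in> padic_ideal p \<Longrightarrow> x \<in> padic_ints p"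
  unfolding padic_ideal_def using padic_ints_mult of_nat_padic_ints by blast

lemma padic_ideal_0: "0 \<in> padic_ideal p"
  unfolding padic_ideal_def using padic_ints_0 by (metis image_eqI mult_zero_right)

lemma padic_ideal_add: "x \<in> padic_ideal p \<Longrightarrow> y \<in> padic_ideal p \<Longrightarrow> x + y \<in> padic_ideal p"
  unfolding padic_ideal_def by (auto simp: distrib_left[symmetric] intro: padic_ints_add)

lemma padic_ideal_mult: "x \<in> padic_ideal p \<Longrightarrow> y \<in> padic_ints p \<Longrightarrow> y * x \<in> padic_ideal p"
  unfolding padic_ideal_def using padic_ints_mult by (auto simp: mult.left_commute)

lemma padic_ideal_sum: "(\<And>i. i \<in> I \<Longrightarrow> f i \<in> padic_ideal p) \<Longrightarrow> sum f I \<in> padic_ideal p"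
  by (induction I rule: infinite_finite_induct) (auto intro: padic_ideal_0 padic_ideal_add)

lemma of_nat_power_padic_ideal: "k \<ge> 1 \<Longrightarrow> of_nat p ^ k \<in> padic_ideal p"
  unfolding padic_ideal_def using padic_ints_power[OF of_nat_padic_ints[of p], of "k - 1"]
  by (cases k) auto

lemma padic_ideal_diff_mult:
  assumes "x - x' \<in> padic_ideal p" "y - y' \<in> padic_ideal p" "x' \<in> padic_ints p" "y \<in> padic_ints p"
  shows "x * y - x' * y' \<in> padic_ideal p"
proof -
  have "x * y - x' * y' = y * (x - x') + x' * (y - y')" by (simp add: algebra_simps)
  then show ?thesis using assms by (auto intro!: padic_ideal_add padic_ideal_mult)
qed

lemma integral_fps_mult: "integral_fps p f \<Longrightarrow> integral_fps p g \<Longrightarrow> integral_fps p (f * g)"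
  unfolding integral_fps_def fps_mult_nth by (auto intro!: padic_ints_sum padic_ints_mult)

lemma integral_fps_1: "integral_fps p 1"
  unfolding integral_fps_def by (auto simp: padic_ints_0 padic_ints_1)

lemma integral_fps_power: "integral_fps p f \<Longrightarrow> integral_fps p (f ^ n)"
  by (induction n) (auto intro: integral_fps_mult integral_fps_1)

lemma integral_fps_add: "integral_fps p f \<Longrightarrow> integral_fps p g \<Longrightarrow> integral_fps p (f + g)"
  unfolding integral_fps_def by (auto intro: padic_ints_add)

lemma integral_fps_diff: "integral_fps p f \<Longrightarrow> integral_fps p g \<Longrightarrow> integral_fps p (f - g)"
  unfolding integral_fps_def by (auto intro: padic_ints_diff)

lemma integral_fps_X: "integral_fps p fps_X"
  unfolding integral_fps_def by (auto simp: fps_X_nth padic_ints_0 padic_ints_1)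

lemma integral_fps_of_nat: "integral_fps p (of_nat n)"
  unfolding integral_fps_def by (auto simp: fps_nth_of_nat padic_ints_0 of_nat_padic_ints)

lemma integral_fps_deriv: "integral_fps p f \<Longrightarrow> integral_fps p (fps_deriv f)"
  unfolding integral_fps_def fps_deriv_nth by (intro allI padic_ints_mult of_nat_padic_ints) auto

lemma integral_fps_inverse:
  assumes f: "integral_fps p f" "fps_nth f 0 = 1"
  shows "integral_fps p (inverse f)"
  unfolding integral_fps_def
proof
  fix n show "fps_nth (inverse f) n \<in> padic_ints p"
  proof (induction n rule: less_induct)
    case (less n)
    show ?case
    proof (cases n)
      case 0 then show ?thesis by (simp add: f(2) padic_ints_1)
    next
      case (Suc k)
      have "f * inverse f = 1" by (rule inverse_mult_eq_1') (simp add: f(2))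
      then have "fps_nth (f * inverse f) n = 0" by (simp add: Suc)
      then have "fps_nth (inverse f) n = - (\<Sum>i=1..n. fps_nth f i * fps_nth (inverse f) (n - i))"
        unfolding fps_mult_nth by (subst (asm) sum.atLeast_Suc_atMost) (auto simp: f(2) add_eq_0_iff)
      also have "\<dots> \<in> padic_ints p"
        using f(1) less by (intro padic_ints_uminus padic_ints_sum padic_ints_mult)
          (auto simp: integral_fps_def)
      finally show ?thesis .
    qed
  qed
qed

lemma integral_crit_fps: "integral_fps p (crit_fps d k)"
  by (induction k) (auto intro!: integral_fps_1 integral_fps_add integral_fps_power integral_fps_X simp del: sum.atMost_Suc)

text \<open>
  Differentiating the recursion for \<^term>\<open>crit_fps d k\<close> shows that the logarithmic derivative
  changes by the logarithmic derivative of \<open>1 + x ^ N / q\<^sub>k ^ d\<close> divided by \<open>d ^ (k + 1)\<close>; the former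
  is integral and starts at the order \<open>N - 1\<close>.
\<close>
lemma log_deriv_Suc:
  assumes d: "d \<ge> 2"
  defines "N k \<equiv> (\<Sum>i\<le>k. d ^ i)"
  shows "\<exists>v. integral_fps p v \<and>
    log_deriv d (Suc k) - log_deriv d k = fps_const (1 / of_nat d ^ Suc k) * (fps_X ^ (N k - 1) * v)"
proof (intro exI conjI)
  let ?q = "crit_fps d k" and ?q' = "crit_fps d (Suc k)"
  have q0: "fps_nth ?q 0 = 1" and q0': "fps_nth ?q' 0 = 1"
    using crit_fps_nth_0[OF d] by blast+
  have inv: "?q * inverse ?q = 1" "?q' * inverse ?q' = 1"
    by (rule inverse_mult_eq_1'; simp only: q0 q0'; simp)+
  have "(d - 1) * N k + 1 = d ^ Suc k" unfolding N_def by (rule geometric_sum_nat[OF d])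
  then have "N k \<noteq> 0" using d by (metis Suc_eq_plus1 add_0 mult_0_right one_less_power less_irrefl
     Suc_1 Suc_le_eq zero_less_Suc)
  then obtain M where M: "N k = Suc M" by (cases "N k") auto
  obtain e where e: "d = Suc e" using d by (cases d) auto
  define v where "v = (of_nat (N k) * ?q - of_nat d * (fps_X * fps_deriv ?q)) * inverse ?q * inverse ?q'"
  show "integral_fps p v"
    unfolding v_def
    by (intro integral_fps_mult integral_fps_inverse integral_fps_diff integral_fps_of_nat integral_fps_X
        integral_fps_deriv integral_crit_fps q0 q0')
  have dq: "fps_deriv ?q' = of_nat d * fps_deriv ?q * ?q ^ e + of_nat (N k) * fps_X ^ M"
    unfolding crit_fps.simps N_def[symmetric] fps_deriv_add fps_deriv_power' by (simp add: e M)
  have q': "?q' = ?q ^ e * ?q + fps_X ^ M * fps_X"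
    unfolding crit_fps.simps N_def[symmetric] by (simp add: e M mult.commute)
  have "fps_deriv ?q' * ?q - of_nat d * fps_deriv ?q * ?q' =
      fps_X ^ M * (of_nat (N k) * ?q - of_nat d * (fps_X * fps_deriv ?q))"
    unfolding dq by (subst q') (simp add: algebra_simps)
  then have "(fps_deriv ?q' * ?q - of_nat d * fps_deriv ?q * ?q') * (inverse ?q * inverse ?q') = fps_X ^ M * v"
    by (simp add: v_def mult_ac)
  moreover have "(fps_deriv ?q' * ?q - of_nat d * fps_deriv ?q * ?q') * (inverse ?q * inverse ?q')
     = fps_deriv ?q' * inverse ?q' * (?q * inverse ?q) - of_nat d * (fps_deriv ?q * inverse ?q * (?q' * inverse ?q'))"
    unfolding left_diff_distrib by (simp only: mult_ac)
  ultimately have v: "fps_deriv ?q' * inverse ?q' - of_nat d * (fps_deriv ?q * inverse ?q) = fps_X ^ M * v"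
    by (simp only: inv mult_1_right)
  have "fps_const (1 / of_nat d ^ k) = fps_const (1 / of_nat d ^ Suc k) * (of_nat d :: complex fps)"
    unfolding fps_of_nat[symmetric, of d, where ?'a = complex] fps_const_mult using d by simp
  then have "log_deriv d (Suc k) - log_deriv d k = fps_const (1 / of_nat d ^ Suc k) *
      (fps_deriv ?q' * inverse ?q' - of_nat d * (fps_deriv ?q * inverse ?q))"
    unfolding log_deriv_def by (simp only: right_diff_distrib mult.assoc)
  then show "log_deriv d (Suc k) - log_deriv d k = fps_const (1 / of_nat d ^ Suc k) * (fps_X ^ (N k - 1) * v)"
    unfolding v by (simp add: M)
qed

lemma geometric_sum_ge:
  fixes d :: nat
  assumes "d \<ge> 2" "k \<ge> 1"
  shows "(\<Sum>i\<le>k. d ^ i) \<ge> k + 2"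
  using assms(2)
proof (induction k rule: dec_induct)
  case base
  then show ?case using assms(1) by simp
next
  case (step k)
  have "d ^ Suc k > 0" using assms(1) by simp
  then show ?case using step.IH unfolding sum.atMost_Suc by linarith
qed

text \<open>
  For \<open>k \<ge> 1\<close>, the denominator \<open>d ^ (k + 1)\<close> in the step from \<open>k\<close> to \<open>k + 1\<close> only affects coefficients of index
  at least \<open>k + 1\<close>, where the scaling provides a factor \<open>p ^ (t (k + 2))\<close>.
\<close>
lemma log_deriv_cong:
  assumes d: "d = p ^ t * d'" "d \<ge> 2" "t \<ge> 1" "\<not> p dvd d'" and N: "N \<ge> 1"
  shows "of_nat p ^ (t * (n + 1)) * (fps_nth (log_deriv d N) n - fps_nth (log_deriv d 1) n) \<in> padic_ideal p"
  using N
proof (induction N rule: dec_induct)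
  case base
  then show ?case by (simp add: padic_ideal_0)
next
  case (step k)
  obtain v where v: "integral_fps p v" "log_deriv d (Suc k) - log_deriv d k =
      fps_const (1 / of_nat d ^ Suc k) * (fps_X ^ ((\<Sum>i\<le>k. d ^ i) - 1) * v)"
    using log_deriv_Suc[OF d(2), of k] by blast
  let ?P = "of_nat p ^ (t * (n + 1)) :: complex"
  have "fps_nth (log_deriv d (Suc k)) n - fps_nth (log_deriv d k) n = fps_nth (log_deriv d (Suc k) - log_deriv d k) n"
    by simp
  also have "\<dots> = 1 / of_nat d ^ Suc k * fps_nth (fps_X ^ ((\<Sum>i\<le>k. d ^ i) - 1) * v) n"
    unfolding v(2) by simp
  finally have diff: "fps_nth (log_deriv d (Suc k)) n - fps_nth (log_deriv d k) n = \<dots>" .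
  have "?P * (1 / of_nat d ^ Suc k * fps_nth (fps_X ^ ((\<Sum>i\<le>k. d ^ i) - 1) * v) n) \<in> padic_ideal p"
  proof (cases "n < (\<Sum>i\<le>k. d ^ i) - 1")
    case True
    then show ?thesis by (simp add: fps_X_power_mult_nth padic_ideal_0 del: sum.atMost_Suc)
  next
    case False
    then have "k + 1 \<le> n" using geometric_sum_ge[OF d(2) step.hyps(1)] by linarith
    then have n: "n + 1 = (k + 1) + (n - k)" "n - k \<ge> 1" by auto
    have "?P = of_nat p ^ (t * (k + 1)) * of_nat p ^ (t * (n - k))"
      by (subst n(1)) (simp only: distrib_left power_add)
    moreover have "(of_nat d :: complex) ^ Suc k = of_nat p ^ (t * (k + 1)) * of_nat d' ^ Suc k"
      unfolding d(1) by (simp add: power_mult_distrib power_mult[symmetric] del: power_Suc)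
    moreover have "of_nat p \<noteq> (0::complex)" using p by (auto simp: prime_gt_0_nat)
    ultimately have "?P * (1 / of_nat d ^ Suc k * fps_nth (fps_X ^ ((\<Sum>i\<le>k. d ^ i) - 1) * v) n) =
        ((1 / of_nat d') ^ Suc k * fps_nth v (n - ((\<Sum>i\<le>k. d ^ i) - 1))) * of_nat p ^ (t * (n - k))"
      using False by (simp add: fps_X_power_mult_nth power_divide del: sum.atMost_Suc power_Suc)
    also have "\<dots> \<in> padic_ideal p"
      using v(1) n(2) d(3,4)
      by (intro padic_ideal_mult of_nat_power_padic_ideal padic_ints_mult padic_ints_power
         padic_ints_inverse_of_nat) (auto simp: integral_fps_def)
    finally show ?thesis .
  qed
  from padic_ideal_add[OF step.IH this] show ?case
    unfolding diff[symmetric] by (simp add: algebra_simps)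
qed

lemma scaled_solution_rec:
  fixes y l :: "complex fps" and c :: complex
  assumes y: "fps_deriv y = l * (1 + of_nat m * y)"
  shows "c ^ (n + 1) * fact (n + 1) * fps_nth y (n + 1) = c ^ (n + 1) * fact n * fps_nth l n +
    of_nat m * (\<Sum>i=0..n. of_nat (n choose i) * (c ^ (i + 1) * fact i * fps_nth l i) *
      (c ^ (n - i) * fact (n - i) * fps_nth y (n - i)))"
proof -
  have "fps_nth (fps_deriv y) n = fps_nth (l + of_nat m * (l * y)) n"
    unfolding y by (simp only: distrib_left mult_1_right mult.left_commute)
  also have "\<dots> = fps_nth l n + of_nat m * (\<Sum>i=0..n. fps_nth l i * fps_nth y (n - i))"
    by (simp only: fps_add_nth fps_mult_of_nat_nth) (simp only: fps_mult_nth)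
  finally have *: "of_nat (n + 1) * fps_nth y (n + 1) =
      fps_nth l n + of_nat m * (\<Sum>i=0..n. fps_nth l i * fps_nth y (n - i))" by simp
  have "fact (n + 1) = (of_nat (n + 1) * fact n :: complex)" by (metis Suc_eq_plus1 fact_Suc)
  then have "c ^ (n + 1) * fact (n + 1) * fps_nth y (n + 1) =
      c ^ (n + 1) * fact n * (of_nat (n + 1) * fps_nth y (n + 1))" by simp
  also have "\<dots> = c ^ (n + 1) * fact n * fps_nth l n +
      of_nat m * (c ^ (n + 1) * fact n * (\<Sum>i=0..n. fps_nth l i * fps_nth y (n - i)))"
    unfolding * distrib_left by simp
  also have "c ^ (n + 1) * fact n * (\<Sum>i=0..n. fps_nth l i * fps_nth y (n - i)) =
      (\<Sum>i=0..n. of_nat (n choose i) * (c ^ (i + 1) * fact i * fps_nth l i) *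
      (c ^ (n - i) * fact (n - i) * fps_nth y (n - i)))"
    unfolding sum_distrib_left
  proof (intro sum.cong refl)
    fix i assume "i \<in> {0..n}"
    then have i: "i \<le> n" by simp
    have "c ^ (n + 1) = c ^ (i + 1) * c ^ (n - i)" using i by (simp flip: power_add)
    moreover have "fact n = (of_nat (n choose i) * fact i * fact (n - i) :: complex)"
      using binomial_fact_lemma[OF i, THEN arg_cong, of "of_nat :: nat \<Rightarrow> complex"]
      by (simp add: mult_ac)
    ultimately show "c ^ (n + 1) * fact n * (fps_nth l i * fps_nth y (n - i)) =
      of_nat (n choose i) * (c ^ (i + 1) * fact i * fps_nth l i) *
      (c ^ (n - i) * fact (n - i) * fps_nth y (n - i))" by (simp only: mult_ac)
  qed
  finally show ?thesis .
qed

text \<open>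
  In terms of the coefficients scaled by \<open>c ^ n n!\<close>, the differential equation becomes a recursion
  with binomial, hence integral, coefficients. So congruences between the right-hand sides are inherited by the
  solutions.
\<close>
lemma scaled_solution_cong:
  fixes y l y' l' :: "complex fps" and c :: complex
  assumes y: "fps_deriv y = l * (1 + of_nat m * y)" "fps_nth y 0 = 0"
    and y': "fps_deriv y' = l' * (1 + of_nat m * y')" "fps_nth y' 0 = 0"
    and l': "\<And>n. c ^ (n + 1) * fact n * fps_nth l' n \<in> padic_ints p"
    and ll': "\<And>n. c ^ (n + 1) * fact n * fps_nth l n - c ^ (n + 1) * fact n * fps_nth l' n \<in> padic_ideal p"
  shows "c ^ n * fact n * fps_nth y n \<in> padic_ints p \<and>
    c ^ n * fact n * fps_nth y n - c ^ n * fact n * fps_nth y' n \<in> padic_ideal p"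
proof -
  define L where "L n = c ^ (n + 1) * fact n * fps_nth l n" for n
  define L' where "L' n = c ^ (n + 1) * fact n * fps_nth l' n" for n
  define Y where "Y n = c ^ n * fact n * fps_nth y n" for n
  define Y' where "Y' n = c ^ n * fact n * fps_nth y' n" for n
  have L': "L' n \<in> padic_ints p" and LL': "L n - L' n \<in> padic_ideal p" for n
    using l' ll' by (simp_all only: L_def L'_def)
  have L: "L n \<in> padic_ints p" for n
    using padic_ints_add[OF L'[of n] padic_ideal_subset[OF LL'[of n]]] by simp
  have rec: "Y (k + 1) = L k + of_nat m * (\<Sum>i=0..k. of_nat (k choose i) * (L i * Y (k - i)))" for k
    unfolding Y_def L_def scaled_solution_rec[OF y(1)] by (simp only: mult.assoc)
  have rec': "Y' (k + 1) = L' k + of_nat m * (\<Sum>i=0..k. of_nat (k choose i) * (L' i * Y' (k - i)))" for k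
    unfolding Y'_def L'_def scaled_solution_rec[OF y'(1)] by (simp only: mult.assoc)
  have "Y n \<in> padic_ints p \<and> Y n - Y' n \<in> padic_ideal p" for n
  proof (induction n rule: less_induct)
    case (less n)
    show ?case
    proof (cases n)
      case 0
      then show ?thesis by (simp add: Y_def Y'_def y y' padic_ints_0 padic_ideal_0)
    next
      case (Suc k)
      have IH: "Y (k - i) \<in> padic_ints p" "Y (k - i) - Y' (k - i) \<in> padic_ideal p" for i
        using less[of "k - i"] Suc by auto
      have 1: "Y (k + 1) \<in> padic_ints p"
        unfolding rec
        by (intro padic_ints_add[OF L] padic_ints_mult[OF of_nat_padic_ints] padic_ints_sum padic_ints_mult[OF L] IH(1))
      have "Y (k + 1) - Y' (k + 1) = (L k - L' k) + of_nat m *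
          (\<Sum>i=0..k. of_nat (k choose i) * (L i * Y (k - i) - L' i * Y' (k - i)))"
        unfolding rec rec' by (simp add: right_diff_distrib sum_subtractf)
      also have "\<dots> \<in> padic_ideal p"
      proof (rule padic_ideal_add[OF LL' padic_ideal_mult[OF padic_ideal_sum of_nat_padic_ints]])
        fix i
        show "of_nat (k choose i) * (L i * Y (k - i) - L' i * Y' (k - i)) \<in> padic_ideal p"
          by (rule padic_ideal_mult[OF padic_ideal_diff_mult[OF LL' IH(2) L' IH(1)] of_nat_padic_ints])
      qed
      finally show ?thesis using 1 Suc by simp
    qed
  qed
  then show ?thesis unfolding Y_def Y'_def by blast
qed

end

lemma log_deriv_1: "d \<ge> 2 \<Longrightarrow> log_deriv d 1 = fps_const (1 / of_nat d) * inverse (1 + fps_X)"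
  by (simp add: log_deriv_def)

text \<open>
  For \<open>m > 0\<close> this is the binomial series of \<open>((1 + x) powr (m / d) - 1) / m\<close>; for \<open>m = 0\<close> it is
  the series of \<open>log (1 + x) / d\<close>.
\<close>
lemma model_solution:
  fixes d m :: nat
  assumes d: "d \<ge> 2"
  defines "y \<equiv> Abs_fps (\<lambda>n. if n = 0 then 0 else
      (\<Prod>j=1..<n. of_int (int m - int (j * d))) / (of_nat d ^ n * fact n) :: complex)"
  shows "fps_deriv y = log_deriv d 1 * (1 + of_nat m * y)" "fps_nth y 0 = 0"
proof -
  show "fps_nth y 0 = 0" by (simp add: y_def)
  have "of_nat d * ((1 + fps_X) * fps_deriv y) = 1 + of_nat m * y"
  proof (rule fps_ext)
    fix n
    have d0: "of_nat d \<noteq> (0::complex)" using d by simp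
    show "fps_nth (of_nat d * ((1 + fps_X) * fps_deriv y)) n = fps_nth (1 + of_nat m * y) n"
    proof (cases n)
      case 0
      then show ?thesis using d0 by (simp add: y_def fps_mult_of_nat_nth distrib_right)
    next
      case (Suc k)
      let ?P = "\<Prod>j=1..<n. of_int (int m - int (j * d)) :: complex"
      have "fps_nth (of_nat d * ((1 + fps_X) * fps_deriv y)) n =
          of_nat d * (of_nat (n + 1) * fps_nth y (n + 1) + of_nat n * fps_nth y n)"
        by (simp add: fps_mult_of_nat_nth distrib_right Suc)
      also have "fps_nth y (n + 1) = ?P * (of_nat m - of_nat n * of_nat d) / (of_nat d ^ (n + 1) * fact (n + 1))"
        by (simp add: y_def Suc prod.atLeastLessThan_Suc)
      also have "of_nat (n + 1) * (?P * (of_nat m - of_nat n * of_nat d) / (of_nat d ^ (n + 1) * fact (n + 1)))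
          = ?P * (of_nat m - of_nat n * of_nat d) / (of_nat d ^ (n + 1) * fact n)"
      proof -
        have aux: "N * (x / (D * (N * f))) = x / (D * f)" if "N \<noteq> 0" for N x D f :: complex
          using that by (simp add: mult.left_commute[of D N])
        moreover have "of_nat (n + 1) \<noteq> (0 :: complex)" by (simp only: of_nat_eq_0_iff)
        moreover have "fact (n + 1) = (of_nat (n + 1) * fact n :: complex)" by (metis Suc_eq_plus1 fact_Suc)
        ultimately show ?thesis by (simp only: aux)
      qed
      also have "fps_nth y n = ?P / (of_nat d ^ n * fact n)"
        by (simp add: y_def Suc)
      also have "of_nat d * (?P * (of_nat m - of_nat n * of_nat d) / (of_nat d ^ (n + 1) * fact n) +
          of_nat n * (?P / (of_nat d ^ n * fact n))) = of_nat m * (?P / (of_nat d ^ n * fact n))"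
      proof -
        have "D * (P * (x - n * D) / (E * D * f) + n * (P / (E * f))) = x * (P / (E * f))"
          if "D \<noteq> 0" for D P x n E f :: complex
        proof -
          have "P * (x - n * D) / (E * D * f) = (P / (E * f)) * ((x - n * D) / D)" by simp
          then have "D * (P * (x - n * D) / (E * D * f) + n * (P / (E * f))) =
              (P / (E * f)) * (D * ((x - n * D) / D + n))" by (simp only: distrib_left mult_ac)
          also have "D * ((x - n * D) / D + n) = x" using that by (simp add: distrib_left)
          finally show ?thesis by (simp only: mult.commute)
        qed
        from this[OF d0] show ?thesis unfolding power_add power_one_right .
      qed
      also have "?P / (of_nat d ^ n * fact n) = fps_nth y n"
        by (simp add: y_def Suc)
      also have "of_nat m * fps_nth y n = fps_nth (1 + of_nat m * y) n"
        by (simp add: fps_mult_of_nat_nth Suc)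
      finally show ?thesis .
    qed
  qed
  then have "log_deriv d 1 * (1 + of_nat m * y) = log_deriv d 1 * (of_nat d * ((1 + fps_X) * fps_deriv y))"
    by simp
  also have "\<dots> = (fps_const (1 / of_nat d) * of_nat d) * (inverse (1 + fps_X) * (1 + fps_X)) * fps_deriv y"
    unfolding log_deriv_1[OF d] by (simp only: mult_ac)
  also have "inverse (1 + fps_X) * (1 + fps_X) = (1 :: complex fps)"
    by (rule inverse_mult_eq_1) simp
  also have "fps_const (1 / of_nat d) * of_nat d = (1 :: complex fps)"
    unfolding fps_of_nat[symmetric, of d, where ?'a = complex] fps_const_mult using d by simp
  finally show "fps_deriv y = log_deriv d 1 * (1 + of_nat m * y)" by simp
qed

fun ode_coeff :: "(nat \<Rightarrow> complex) \<Rightarrow> complex \<Rightarrow> nat \<Rightarrow> complex" where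
  "ode_coeff l \<mu> 0 = 0"
| "ode_coeff l \<mu> (Suc n) = (l n + \<mu> * (\<Sum>i=0..n. l i * ode_coeff l \<mu> (n - i))) / of_nat (Suc n)"

lemma fps_linear_ode_solution:
  fixes l :: "complex fps"
  obtains y where "fps_deriv y = l * (1 + of_nat m * y)" "fps_nth y 0 = 0"
proof
  let ?y = "Abs_fps (ode_coeff (fps_nth l) (of_nat m))"
  show "fps_deriv ?y = l * (1 + of_nat m * ?y)"
  proof (rule fps_ext)
    fix n
    have "fps_nth (fps_deriv ?y) n = fps_nth l n + of_nat m * (\<Sum>i=0..n. fps_nth l i * fps_nth ?y (n - i))"
      by (simp del: of_nat_Suc)
    also have "\<dots> = fps_nth (l + of_nat m * (l * ?y)) n"
      by (simp only: fps_add_nth fps_mult_of_nat_nth) (simp only: fps_mult_nth)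
    also have "l + of_nat m * (l * ?y) = l * (1 + of_nat m * ?y)"
      by (simp only: distrib_left mult_1_right mult.left_commute)
    finally show "fps_nth (fps_deriv ?y) n = fps_nth (l * (1 + of_nat m * ?y)) n" .
  qed
qed simp

section \<open>Valuations of the coefficients\<close>

lemma padic_valuation_eqI:
  assumes p: "prime p" and x: "x = of_nat p powi v * of_int r / of_int q" "\<not> int p dvd r" "\<not> int p dvd q"
  shows "padic_valuation p x = ereal (of_int v)"
proof -
  have rq0: "r \<noteq> 0" "q \<noteq> 0" using x by auto
  have p0: "of_nat p \<noteq> (0 :: rat)" using p by (simp add: prime_gt_0_nat)
  have pp: "prime (int p)" using p by simp
  have le: "w \<le> v" if "of_nat p powi v * of_int r / of_int q = (of_nat p powi w * of_int r' / of_int q' :: rat)"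
      "\<not> int p dvd r" "\<not> int p dvd q'" "q \<noteq> 0" "q' \<noteq> 0" for v w :: int and r q r' q' :: int
  proof (rule ccontr)
    assume "\<not> w \<le> v"
    define n where "n = nat (w - v)"
    have n: "w = v + int n" "n > 0" using \<open>\<not> w \<le> v\<close> by (auto simp: n_def)
    from that(1) have "of_nat p powi v * (of_int (r * q') :: rat) = of_nat p powi w * of_int (r' * q)"
      using that(4,5) by (simp add: field_simps)
    also have "\<dots> = of_nat p powi v * (of_int (int p ^ n * (r' * q)))"
      using p0 by (simp add: n(1) power_int_add)
    finally have "(of_int (r * q') :: rat) = of_int (int p ^ n * (r' * q))"
      using p0 by simp
    then have "r * q' = int p ^ n * (r' * q)" by (simp only: of_int_eq_iff)
    then have "int p dvd r * q'" using n(2) by (simp add: dvd_power)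
    then show False using pp that(2,3) by (simp add: prime_dvd_mult_iff)
  qed
  have "x \<noteq> 0" using x(1) rq0 p0 by simp
  moreover have "(THE v. \<exists>r q. \<not> int p dvd r \<and> \<not> int p dvd q \<and> x = of_nat p powi v * of_int r / of_int q) = v"
  proof (rule the_equality)
    fix w assume "\<exists>r q. \<not> int p dvd r \<and> \<not> int p dvd q \<and> x = of_nat p powi w * of_int r / of_int q"
    then obtain r' q' where w: "\<not> int p dvd r'" "\<not> int p dvd q'" "x = of_nat p powi w * of_int r' / of_int q'"
      by blast
    then have "q' \<noteq> 0" by auto
    have eq: "of_nat p powi v * of_int r / of_int q = (of_nat p powi w * of_int r' / of_int q' :: rat)"
      using x(1) w(3) by simp
    have "w \<le> v" by (rule le[OF eq x(2) w(2) rq0(2) \<open>q' \<noteq> 0\<close>])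
    moreover have "v \<le> w" by (rule le[OF eq[symmetric] w(1) x(3) \<open>q' \<noteq> 0\<close> rq0(2)])
    ultimately show "w = v" by simp
  qed (use x in blast)
  ultimately show ?thesis by (simp add: padic_valuation_def)
qed

lemma int_prime_power_decompose:
  assumes p: "prime p" and "x \<noteq> 0"
  obtains k y where "x = int p ^ k * y" "\<not> int p dvd y"
  using multiplicity_decompose'[of x "int p"] assms by (metis not_prime_unit prime_nat_int_transfer)

text \<open>
  Every factor is congruent to \<open>m\<close> modulo \<open>p\<close>, and the product is empty exactly for \<open>a = 1\<close>,
  that is, for \<open>m = d - 2\<close>.
\<close>
lemma model_unit_iff:
  fixes m d a p :: nat
  assumes p: "prime p" "p dvd d" and d: "d \<ge> 2" and am: "(d - 1) * a = m + 1"
  shows "int p dvd (\<Prod>j=1..<a. int m - int (j * d)) \<longleftrightarrow> \<not> (m = d - 2 \<or> \<not> p dvd m)"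
proof -
  have "int p dvd int m - int (j * d) \<longleftrightarrow> p dvd m" for j
  proof -
    have "int p dvd int (j * d)" using p(2) by (simp only: int_dvd_int_iff dvd_mult)
    then show ?thesis by (metis dvd_diff_right_iff dvd_diff_left_iff int_dvd_int_iff)
  qed
  then have "int p dvd (\<Prod>j=1..<a. int m - int (j * d)) \<longleftrightarrow> {1..<a} \<noteq> {} \<and> p dvd m"
    using p(1) by (subst prime_dvd_prod_iff) auto
  moreover have "a \<ge> 1" using am by (cases a) auto
  moreover have "m = d - 2 \<longleftrightarrow> a = 1"
  proof
    assume "m = d - 2"
    then have "(d - 1) * a = (d - 1) * 1" using am d by simp
    then show "a = 1" using d by (simp only: mult_cancel1) auto
  qed (use am in auto)
  ultimately show ?thesis by auto
qed

text \<open>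
  The scaled coefficient \<open>Y = p ^ (t a) a! y\<^sub>a\<close> is \<open>p\<close>-integral and congruent modulo \<open>p\<close> to the scaled
  coefficient of the model solution, which is a product of integers divided by a power of \<open>d'\<close>.
  So \<open>Y\<close> is a unit if and only if \<open>p\<close> does not divide this product.
\<close>
lemma solution_valuation:
  fixes d m a p t d' N :: nat and y :: "complex fps"
  assumes p: "prime p" and d: "d = p ^ t * d'" "d \<ge> 2" "t \<ge> 1" "\<not> p dvd d'" and N: "N \<ge> 1"
    and am: "(d - 1) * a = m + 1"
    and y: "fps_deriv y = log_deriv d N * (1 + of_nat m * y)" "fps_nth y 0 = 0"
  shows "\<exists>q. - fps_nth y a = of_rat q \<and>
    - padic_valuation p q \<le> padic_valuation p (fact a) + ereal (real (t * a)) \<and>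
    (- padic_valuation p q = padic_valuation p (fact a) + ereal (real (t * a)) \<longleftrightarrow> m = d - 2 \<or> \<not> p dvd m)"
proof -
  let ?c = "of_nat p ^ t :: complex"
  define M where "M = (\<Prod>j=1..<a. int m - int (j * d))"
  define y' :: "complex fps" where "y' = Abs_fps (\<lambda>n. if n = 0 then 0 else
      (\<Prod>j=1..<n. of_int (int m - int (j * d))) / (of_nat d ^ n * fact n))"
  have y': "fps_deriv y' = log_deriv d 1 * (1 + of_nat m * y')" "fps_nth y' 0 = 0"
    unfolding y'_def by (rule model_solution[OF d(2)])+
  have a1: "a \<ge> 1" using am by (cases a) auto
  have p0: "of_nat p \<noteq> (0 :: complex)" "of_nat p \<noteq> (0 :: rat)" "p \<noteq> 0" using p by (auto simp: prime_gt_0_nat)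
  have d'0: "d' \<noteq> 0" using d by (auto intro: ccontr)
  have cpow: "?c ^ n = of_nat p ^ (t * n)" for n by (simp add: power_mult)
  have l1: "?c ^ (n + 1) * fact n * fps_nth (log_deriv d 1) n \<in> padic_ints p" for n
  proof -
    have "integral_fps p (inverse (1 + fps_X))"
      by (intro integral_fps_inverse[OF p] integral_fps_add[OF p] integral_fps_1[OF p] integral_fps_X[OF p]) simp
    then have 1: "fps_nth (inverse (1 + fps_X)) n \<in> padic_ints p" by (simp add: integral_fps_def)
    have "?c ^ (n + 1) * fact n * fps_nth (log_deriv d 1) n =
        ?c ^ n * of_nat (fact n) * (1 / of_nat d') * fps_nth (inverse (1 + fps_X)) n"
      unfolding log_deriv_1[OF d(2)] using p0 by (simp add: d(1))
    also have "\<dots> \<in> padic_ints p"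
      by (intro padic_ints_mult[OF p] padic_ints_power[OF p] of_nat_padic_ints[OF p]
          padic_ints_inverse_of_nat[OF p] d(4) 1)
    finally show ?thesis .
  qed
  have ll: "?c ^ (n + 1) * fact n * fps_nth (log_deriv d N) n - ?c ^ (n + 1) * fact n * fps_nth (log_deriv d 1) n
      \<in> padic_ideal p" for n
  proof -
    have "of_nat (fact n) * (of_nat p ^ (t * (n + 1)) * (fps_nth (log_deriv d N) n - fps_nth (log_deriv d 1) n)) \<in> padic_ideal p"
      by (intro padic_ideal_mult[OF p] log_deriv_cong[OF p d N] of_nat_padic_ints[OF p])
    then show ?thesis by (simp only: cpow of_nat_fact right_diff_distrib mult.left_commute mult.assoc)
  qed
  define Y where "Y = ?c ^ a * fact a * fps_nth y a"
  have Y: "Y \<in> padic_ints p" "Y - ?c ^ a * fact a * fps_nth y' a \<in> padic_ideal p"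
    using scaled_solution_cong[OF p y y' l1 ll, of a] by (auto simp: Y_def)
  have "?c ^ a * fact a * fps_nth y' a = of_int M / of_nat d' ^ a"
    using a1 p0 by (simp add: y'_def M_def d(1) power_mult_distrib)
  with Y(2) obtain z where z: "z \<in> padic_ints p" "Y - of_int M / of_nat d' ^ a = of_nat p * z"
    by (auto simp: padic_ideal_def)
  obtain r s where rs: "z = of_int r / of_int s" "\<not> int p dvd s" "s \<noteq> 0"
    by (rule padic_intsE[OF z(1)])
  define u where "u = - (M * s + int p * r * int d' ^ a)"
  define v where "v = int d' ^ a * s"
  have pp: "prime (int p)" using p by simp
  have v: "\<not> int p dvd v" "v \<noteq> 0"
  proof -
    have "\<not> int p dvd int d' ^ a"
      using prime_dvd_power[OF pp, of "int d'" a] d(4) by auto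
    then show "\<not> int p dvd v" using rs(2) pp by (simp add: v_def prime_dvd_mult_iff)
    then show "v \<noteq> 0" by auto
  qed
  have Yuv: "- Y = of_int u / of_int v"
  proof -
    have "Y = of_int M / of_nat d' ^ a + of_nat p * (of_int r / of_int s)"
      using z(2) rs(1) by (simp add: algebra_simps)
    then show ?thesis using rs(3) d'0 by (simp add: u_def v_def add_divide_distrib diff_divide_distrib)
  qed
  have "int p dvd u \<longleftrightarrow> int p dvd M"
  proof -
    have "int p dvd u \<longleftrightarrow> int p dvd M * s" unfolding u_def dvd_minus_iff by (simp add: dvd_add_left_iff mult.assoc)
    also have "\<dots> \<longleftrightarrow> int p dvd M" using pp rs(2) by (simp add: prime_dvd_mult_iff)
    finally show ?thesis .
  qed
  also have "\<dots> \<longleftrightarrow> \<not> (m = d - 2 \<or> \<not> p dvd m)"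
    unfolding M_def by (rule model_unit_iff[OF p _ d(2) am]) (use d(1,3) in auto)
  finally have iff: "int p dvd u \<longleftrightarrow> \<not> (m = d - 2 \<or> \<not> p dvd m)" .
  obtain e f where ef: "(fact a :: int) = int p ^ e * f" "\<not> int p dvd f"
    using int_prime_power_decompose[OF p, of "fact a"] by auto
  have f0: "f \<noteq> 0" using ef(2) by auto
  have "(fact a :: rat) = of_int (fact a)" by simp
  also have "\<dots> = of_nat p powi int e * of_int f / of_int 1" unfolding ef(1) by simp
  finally have vfact: "padic_valuation p (fact a) = ereal (of_int (int e))"
    by (rule padic_valuation_eqI[OF p _ ef(2)]) (use prime_gt_1_nat[OF p] in \<open>simp add: zdvd1_eq\<close>)
  define q :: rat where "q = of_int u / (of_nat p ^ (t * a + e) * of_int (v * f))"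
  have "fact a = (of_int (int p ^ e * f) :: complex)" unfolding ef(1)[symmetric] by simp
  then have "Y = of_nat p ^ (t * a + e) * of_int f * fps_nth y a"
    unfolding Y_def cpow by (simp add: power_add)
  then have "- fps_nth y a = of_rat q"
  proof -
    assume Yy: "Y = of_nat p ^ (t * a + e) * of_int f * fps_nth y a"
    have "of_rat q = (of_int u / of_int v) / (of_nat p ^ (t * a + e) * of_int f :: complex)"
      by (simp add: q_def of_rat_mult of_rat_divide of_rat_power)
    also have "\<dots> = - fps_nth y a"
      unfolding Yuv[symmetric] Yy using p0 f0 by simp
    finally show ?thesis by simp
  qed
  moreover have "- padic_valuation p q \<le> padic_valuation p (fact a) + ereal (real (t * a)) \<and>
    (- padic_valuation p q = padic_valuation p (fact a) + ereal (real (t * a)) \<longleftrightarrow> m = d - 2 \<or> \<not> p dvd m)"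
  proof (cases "u = 0")
    case True
    then have "padic_valuation p q = \<infinity>" by (simp add: q_def padic_valuation_def)
    then show ?thesis using True iff by (simp add: vfact)
  next
    case False
    obtain k w where kw: "u = int p ^ k * w" "\<not> int p dvd w"
      using int_prime_power_decompose[OF p False] by auto
    have "q = of_nat p powi (int k - int (t * a + e)) * of_int w / of_int (v * f)"
      unfolding q_def kw(1) power_int_diff[OF disjI1[OF p0(2)]] power_int_of_nat by simp
    moreover have "\<not> int p dvd v * f" using v(1) ef(2) pp by (simp add: prime_dvd_mult_iff)
    ultimately have "padic_valuation p q = ereal (of_int (int k - int (t * a + e)))"
      by (intro padic_valuation_eqI[OF p _ kw(2)])
    moreover have "k = 0 \<longleftrightarrow> m = d - 2 \<or> \<not> p dvd m"
      using iff kw by (cases k) auto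
    ultimately show ?thesis by (simp add: vfact)
  qed
  ultimately show ?thesis by blast
qed

section \<open>The uniformization and its Laurent coefficients\<close>

lemma laurent_fps:
  assumes b: "laurent_coeffs_at_infinity \<Psi> b"
  defines "B \<equiv> Abs_fps (\<lambda>n. case n of 0 \<Rightarrow> 1 | Suc m \<Rightarrow> b m)"
  shows "fps_conv_radius B \<ge> 1"
    and "0 < cmod x \<Longrightarrow> cmod x < 1 \<Longrightarrow> eval_fps B x = x * the (\<Psi> (Some (1 / x)))"
proof -
  have sums: "(\<lambda>n. fps_nth B n * x ^ n) sums (x * the (\<Psi> (Some (1 / x))))"
    if x: "0 < cmod x" "cmod x < 1" for x
  proof -
    have "cmod (1 / x) > 1" using x by (simp add: norm_divide)
    then have "(\<lambda>m. b m / (1 / x) ^ m) sums (the (\<Psi> (Some (1 / x))) - 1 / x)"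
      using b by (simp add: laurent_coeffs_at_infinity_def)
    then have "(\<lambda>m. x * (b m / (1 / x) ^ m)) sums (x * (the (\<Psi> (Some (1 / x))) - 1 / x))"
      by (rule sums_mult)
    moreover have "x * (b m / (1 / x) ^ m) = fps_nth B (Suc m) * x ^ Suc m" for m
      by (simp add: B_def power_divide)
    ultimately have "(\<lambda>m. fps_nth B (Suc m) * x ^ Suc m) sums (x * (the (\<Psi> (Some (1 / x))) - 1 / x))"
      by simp
    then have "(\<lambda>m. fps_nth B m * x ^ m) sums (x * (the (\<Psi> (Some (1 / x))) - 1 / x) + fps_nth B 0 * x ^ 0)"
      by (rule sums_Suc)
    moreover have "x * (the (\<Psi> (Some (1 / x))) - 1 / x) + fps_nth B 0 * x ^ 0 = x * the (\<Psi> (Some (1 / x)))"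
      using x by (simp add: B_def right_diff_distrib)
    ultimately show ?thesis by simp
  qed
  show "fps_conv_radius B \<ge> 1"
    unfolding fps_conv_radius_def
  proof (rule conv_radius_geI_ex)
    fix r :: real assume r: "0 < r" "ereal r < 1"
    then have "0 < cmod (of_real r)" "cmod (of_real r) < 1" by (simp_all add: one_ereal_def)
    from sums_summable[OF sums[OF this]] show "\<exists>z. cmod z = r \<and> summable (\<lambda>n. fps_nth B n * z ^ n)"
      using r by (intro exI[of _ "of_real r"]) simp
  qed
  show "eval_fps B x = x * the (\<Psi> (Some (1 / x)))" if "0 < cmod x" "cmod x < 1"
    using sums_unique[OF sums[OF that]] by (simp add: eval_fps_def)
qed

text \<open>
  Were \<open>\<Psi>\<close> infinite at a finite point \<open>w\<close>, then by continuity it would be large, or again infinite,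
  at all points near \<open>w\<close>. The former contradicts the continuity of the finite part, the latter injectivity.
\<close>
lemma uniformization_finite:
  assumes hom: "homeomorphic_maps (subtopology riemann_sphere U) (subtopology riemann_sphere exterior_disk) \<Phi> \<Psi>"
    and cont: "continuous_on {w. cmod w > 1} (\<lambda>w. the (\<Psi> (Some w)))" and w: "cmod w > 1"
  shows "\<exists>c. \<Psi> (Some w) = Some c \<and> Some c \<in> U"
proof -
  have cPsi: "continuous_map (subtopology riemann_sphere exterior_disk) riemann_sphere \<Psi>"
    and im: "\<And>x. x \<in> exterior_disk \<Longrightarrow> \<Psi> x \<in> U"
    and inv: "\<And>x. x \<in> exterior_disk \<Longrightarrow> \<Phi> (\<Psi> x) = x"
    using hom by (auto simp: homeomorphic_maps_def continuous_map_in_subtopology)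
  have ext: "Some v \<in> exterior_disk" if "cmod v > 1" for v
    using that by (simp add: exterior_disk_def)
  have "\<Psi> (Some w) \<noteq> None"
  proof
    assume None: "\<Psi> (Some w) = None"
    have op: "open {w. cmod w > 1}" by (intro open_Collect_less continuous_intros)
    \<comment> \<open>The default value \<open>the None\<close> is harmless: the finite part is bounded on a punctured
      neighborhood of \<open>w\<close>, whatever its value at \<open>w\<close>.\<close>
    have "isCont (\<lambda>w. the (\<Psi> (Some w))) w"
      using cont op w by (simp add: continuous_on_eq_continuous_at)
    then have "eventually (\<lambda>v. dist (the (\<Psi> (Some v))) (the (\<Psi> (Some w))) < 1) (at w)"
      unfolding isCont_def by (rule tendstoD) simp
    then have near: "eventually (\<lambda>v. cmod (the (\<Psi> (Some v))) \<le> cmod (the (\<Psi> (Some w))) + 1) (at w)"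
    proof eventually_elim
      case (elim v)
      then show ?case using norm_triangle_ineq2[of "the (\<Psi> (Some v))" "the (\<Psi> (Some w))"]
        by (simp add: dist_norm)
    qed
    let ?R = "cmod (the (\<Psi> (Some w))) + 1"
    define V where "V = insert None (Some ` (UNIV - cball (0 :: complex) ?R))"
    have "openin riemann_sphere V"
      unfolding V_def riemann_sphere_def openin_Alexandroff_compactification
      by (intro disjI2 exI[of _ "cball (0 :: complex) ?R"]) simp
    then have "openin (subtopology riemann_sphere exterior_disk) {x \<in> topspace (subtopology riemann_sphere exterior_disk). \<Psi> x \<in> V}"
      by (rule openin_continuous_map_preimage[OF cPsi])
    then obtain W where W: "openin riemann_sphere W" "{x \<in> exterior_disk. \<Psi> x \<in> V} = W \<inter> exterior_disk"
      by (auto simp: openin_subtopology)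
    have "open (Some -` W)" by (rule openin_sphere_vimage_Some[OF W(1)])
    moreover have "w \<in> Some -` W" using W(2) None ext[OF w] by (auto simp: V_def)
    ultimately have "eventually (\<lambda>v. v \<in> Some -` W) (at w)"
      by (rule eventually_at_in_open')
    moreover have "eventually (\<lambda>v. v \<in> {w. cmod w > 1}) (at w)"
      by (rule eventually_at_in_open'[OF op]) (use w in simp)
    moreover have "eventually (\<lambda>v. v \<noteq> w) (at w)" by (simp add: eventually_at_filter)
    ultimately have "eventually (\<lambda>v. False) (at w)"
      using near
    proof eventually_elim
      case (elim v)
      then have v: "Some v \<in> exterior_disk" by (simp add: ext)
      then have "\<Psi> (Some v) \<in> V" using W(2) elim(1) by auto
      then consider "\<Psi> (Some v) = None" | c where "\<Psi> (Some v) = Some c" "cmod c > ?R"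
        by (auto simp: V_def)
      then show False
      proof cases
        case 1
        then have "Some v = Some w" using inv[OF v] inv[OF ext[OF w]] None by simp
        then show False using elim(3) by simp
      next
        case 2
        then show False using elim(4) by simp
      qed
    qed
    then show False by simp
  qed
  then show ?thesis using im[OF ext[OF w]] by auto
qed

theorem theorem3p4:
  fixes d m a s :: nat
    and p t :: "nat \<Rightarrow> nat"
    and \<Phi> \<Psi> :: "complex option \<Rightarrow> complex option"
    and b :: "nat \<Rightarrow> complex"
  assumes "d \<ge> 2"
    and "(d - 1) dvd (m + 1)"
    and "a = (m + 1) div (d - 1)"
    and "s \<ge> 1"
    and "\<forall>i\<in>{1..s}. prime (p i) \<and> t i \<ge> 1"
    and "inj_on p {1..s}"
    and "d = (\<Prod>i=1..s. p i ^ t i)"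
    and "multibrot_uniformization d \<Phi> \<Psi>"
    and "laurent_coeffs_at_infinity \<Psi> b"
  shows "\<exists>q :: rat. b m = of_rat q \<and>
    (\<forall>i\<in>{1..s}.
       - padic_valuation (p i) q \<le> padic_valuation (p i) (fact a) + ereal (real (t i * a)) \<and>
       (- padic_valuation (p i) q = padic_valuation (p i) (fact a) + ereal (real (t i * a))
          \<longleftrightarrow> m = d - 2 \<or> \<not> p i dvd m))"
proof -
  define B where "B = Abs_fps (\<lambda>n. case n of 0 \<Rightarrow> 1 | Suc m \<Rightarrow> b m)"
  have B0: "fps_nth B 0 = 1" by (simp add: B_def)
  have conv: "fps_conv_radius B \<ge> 1"
    and evalB: "\<And>x. 0 < cmod x \<Longrightarrow> cmod x < 1 \<Longrightarrow> eval_fps B x = x * the (\<Psi> (Some (1 / x)))"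
    unfolding B_def by (rule laurent_fps[OF assms(9)])+
  have finite: "\<exists>c. \<Psi> (Some w) = Some c \<and> c \<notin> multibrot d" if w: "cmod w > 1" for w
  proof -
    have "ereal (cmod x) < fps_conv_radius B" if "cmod x < 1" for x
      by (rule less_le_trans[OF _ conv]) (use that in \<open>simp add: one_ereal_def\<close>)
    then have "ball (0 :: complex) 1 \<subseteq> eball 0 (fps_conv_radius B)"
      unfolding subset_iff in_eball_iff mem_ball dist_0_norm by blast
    then have "continuous_on (ball 0 1) (eval_fps B)"
      by (intro holomorphic_on_imp_continuous_on holomorphic_on_eval_fps)
    moreover have "continuous_on {w. cmod w > 1} (\<lambda>w. 1 / w)"
      by (intro continuous_on_divide continuous_on_const continuous_on_id) auto
    moreover have "(\<lambda>w. 1 / w) ` {w. cmod w > 1} \<subseteq> ball 0 1"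
      by (auto simp: norm_divide divide_simps)
    ultimately have "continuous_on {w. cmod w > 1} (\<lambda>w. eval_fps B (1 / w))"
      by (rule continuous_on_compose2)
    then have "continuous_on {w. cmod w > 1} (\<lambda>w. w * eval_fps B (1 / w))"
      by (intro continuous_on_mult continuous_on_id)
    moreover have "w * eval_fps B (1 / w) = the (\<Psi> (Some w))" if "cmod w > 1" for w
    proof -
      have "w \<noteq> 0" using that by auto
      then show ?thesis using evalB[of "1 / w"] that by (simp add: norm_divide)
    qed
    ultimately have "continuous_on {w. cmod w > 1} (\<lambda>w. the (\<Psi> (Some w)))"
      by (subst (asm) continuous_on_cong[OF refl]) auto
    moreover have "homeomorphic_maps (subtopology riemann_sphere (UNIV - Some ` multibrot d))
        (subtopology riemann_sphere exterior_disk) \<Phi> \<Psi>"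
      using assms(8) by (simp add: multibrot_uniformization_def conformal_homeomorphism_def)
    ultimately show ?thesis using uniformization_finite[OF _ _ w] by blast
  qed
  have esc: "\<exists>n. cmod ((unicrit d (eval_fps B x / x) ^^ n) (eval_fps B x / x)) > cmod (eval_fps B x / x) + 3"
    if x: "0 < cmod x" "cmod x < 1" for x
  proof -
    have "cmod (1 / x) > 1" using x by (simp add: norm_divide)
    then obtain c where c: "\<Psi> (Some (1 / x)) = Some c" "c \<notin> multibrot d" using finite by blast
    then have "eval_fps B x / x = c" using evalB[OF x] x by simp
    moreover have "\<exists>n. cmod ((unicrit d c ^^ n) c) > cmod c + 3"
      using bounded_critical_orbit_imp_multibrot[OF assms(1), of c] c(2) by (meson not_le)
    ultimately show ?thesis by simp
  qed
  define N where "N = m + 2"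
  have "m + 3 \<le> 2 ^ (m + 3)" by (rule less_imp_le[OF less_exp])
  also have "\<dots> \<le> d ^ (m + 3)" using assms(1) by (intro power_mono) auto
  finally have "m + 2 \<le> d ^ Suc N - 1" by (simp add: N_def numeral_3_eq_3)
  then have G: "fps_X ^ (m + 2) dvd crit_laurent d B N - 1"
    using dvd_trans[OF le_imp_power_dvd crit_laurent_near_1[OF assms(1) B0 conv esc]] by blast
  have am: "(d - 1) * a = m + 1" using assms(2,3) by simp
  obtain y where y: "fps_deriv y = log_deriv d N * (1 + of_nat m * y)" "fps_nth y 0 = 0"
    by (rule fps_linear_ode_solution)
  have bm: "b m = - fps_nth y a"
    using lagrange_coeff[OF assms(1) B0 am G y] by (simp add: B_def)
  have val: "\<exists>q. b m = of_rat q \<and>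
    - padic_valuation (p i) q \<le> padic_valuation (p i) (fact a) + ereal (real (t i * a)) \<and>
    (- padic_valuation (p i) q = padic_valuation (p i) (fact a) + ereal (real (t i * a)) \<longleftrightarrow> m = d - 2 \<or> \<not> p i dvd m)"
    if i: "i \<in> {1..s}" for i
    unfolding bm
  proof (rule solution_valuation[OF _ _ assms(1) _ _ _ am y])
    show pi: "prime (p i)" and "t i \<ge> 1" using assms(5) i by auto
    show "d = p i ^ t i * (\<Prod>j\<in>{1..s} - {i}. p j ^ t j)"
      unfolding assms(7) by (rule prod.remove) (use i in auto)
    show "\<not> p i dvd (\<Prod>j\<in>{1..s} - {i}. p j ^ t j)"
    proof
      assume "p i dvd (\<Prod>j\<in>{1..s} - {i}. p j ^ t j)"
      then have "\<exists>j\<in>{1..s} - {i}. p i dvd p j ^ t j"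
        using prime_dvd_prod_iff[of "{1..s} - {i}" "p i" "\<lambda>j. p j ^ t j"] pi by blast
      then obtain j where j: "j \<in> {1..s} - {i}" "p i dvd p j ^ t j" by blast
      then have "p i dvd p j" using pi prime_dvd_power by blast
      then have "p i = p j" using pi j(1) assms(5) by (simp add: primes_dvd_imp_eq)
      then show False using assms(6) i j(1) by (auto dest: inj_onD)
    qed
    show "N \<ge> 1" by (simp add: N_def)
  qed
  obtain q where q: "b m = of_rat q" using val[of 1] assms(4) by auto
  have "q' = q" if "b m = of_rat q'" for q' using that q by simp
  then show ?thesis using q val by metis
qed

end
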